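(* Let $X=(X_1,\dots,X_K)$ be $p$ variables divided into $K$ blocks, with block $k$ consisting of the variables with indices $t_{k-1}+1,\dots,t_k$ (where $0=t_0<t_1<\dots<t_K=p$), let $M=(M_1,\dots,M_K)$ be the corresponding blocks of missingness indicators, and let $X^*=(X_1^*,\dots,X_K^* )$ be the corresponding blocks of materialized variables. Let $R_0=\emptyset$ and let $R_1,\dots,R_{K-1}$ be a sequence of subsets of $\{1,\dots,p\}$ such that $R_k\subseteq\{t_{k-1}+1,\dots,t_k\}\cup R_{k-1}$ for $k=1,\dots,K-1$. Let $A_1,\dots,A_K$ be a sequence of identifying assumptions, where each $A_k$ is an assumption on the conditional distribution of $(X_k,M_k)$ given $(X_{<k},M_{R_{k-1}},X^*_{>k})$ such that, for any given conditional density $g(X_k^*\mid X_{<k},M_{R_{k-1}},X^*_{>k})$, it allows the construction of a conditional density $g_{A_k}(X_k,M_k\mid X_{<k},M_{R_{k-1}},X^*_{>k})$ with the property $$g_{A_k}(X_k^*\mid X_{<k},M_{R_{k-1}},X^*_{>k})=g(X_k^*\mid X_{<k},M_{R_{k-1}},X^*_{>k}).$$ Then, given any observed-data density $f(X^* )$, there exists a full-data density $\tilde f_{A_{\leq K}}(X,M)$ that encodes the assumptions $A_1,\dots,A_K$ and satisfies the non-parametric saturation property $$\tilde f_{A_{\leq K}}(X^* )=f(X^* ).$$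
   Context: **Variables and measures.** There are $p$ scalar-indexed random variables; the $j$-th, written $X_{(j)}$ here to distinguish it from the blocks, takes values in a sample space $\mathcal X_{(j)}$ equipped with a dominating ($\sigma$-finite) measure $\mu_{(j)}$; $\mathcal X=\prod_j\mathcal X_{(j)}$ and $\mu=\bigotimes_j\mu_{(j)}$. The missingness indicator $M_{(j)}\in\{0,1\}$ equals $1$ when $X_{(j)}$ is missing and $0$ when it is observed. A full-data density is a probability density of $(X,M)$ on $\mathcal X\times\{0,1\}^p$ with respect to the product $\nu$ of $\mu$ and counting measure on $\{0,1\}^p$. **Materialized variables.** With $*$ a placeholder symbol not in any $\mathcal X_{(j)}$, put $X_{(j)}^*=X_{(j)}$ if $M_{(j)}=0$ and $X_{(j)}^*=*$ if $M_{(j)}=1$. Thus $X_{(j)}^*$ takes values in $\mathcal X_{(j)}\cup\{*\}$, dominated by $\mu_{(j)}$ plus a unit point mass at $*$. $X^*$ carries exactly the information in $M$ and the observed variables: for $m\in\{0,1\}^p$, let $x_m=(x_{(j)}:m_j=1)$ and $x_{\bar m}=(x_{(j)}:m_j=0)$; the value $x^*=x^*(m,x_{\bar m})$ has entries $*$ where $m_j=1$ and $x_{(j)}$ where $m_j=0$, and the event $X^*=x^*(m,x_{\bar m})$ is the same as $M=m$, $X_{\bar m}=x_{\bar m}$. An observed-data density $f(X^* )$ is a probability density for $X^*$. A full-data density $h(X,M)$ implies the observed-data density $$h(X^*=x^*(m,x_{\bar m}))=\int_{\mathcal X_m}h(X=x,M=m)\,\mu(dx_m),$$ where $\mathcal X_m$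 is the sample space of $x_m$. The same convention applies blockwise and conditionally: from a (conditional) density of $(X_k,M_k)$ one obtains the implied (conditional) density of $X_k^*$ by integrating out, for each value of $M_k$, the entries of $X_k$ that are missing according to $M_k$; this is what is meant by $g_{A_k}(X_k^*\mid\cdots)$. **Block notation.** $X_k=(X_{(t_{k-1}+1)},\dots,X_{(t_k)})$, and similarly $M_k$, $X_k^*$; $X_{<k}=(X_1,\dots,X_{k-1})$, $X_{\leq k}=(X_1,\dots,X_k)$, $X^*_{>k}=(X^*_{k+1},\dots,X^*_K)$ (empty for $k=K$). For a set $R$ of indices, $M_R=(M_{(j)}:j\in R)$. The same letter $f$ (or $g$, $h$) is used for a density and for its marginal and conditional densities, distinguished by their arguments. Densities are understood up to almost-everywhere equality, and conditional densities may be fixed arbitrarily where the conditioning density vanishes. **Identifying assumptions.** Each $A_k$ acts as a rule that sends a conditional density $g(X_k^*\mid X_{<k},M_{R_{k-1}},X^*_{>k})$ to a conditional density $g_{A_k}(X_k,M_k\mid X_{<k},M_{R_{k-1}},X^*_{>k})$ having the property displayed in the claim. **Sequentially identified densities.** Given $f(X^* )$, set $f_{A_{\leq 0}}=f$, a density of $X^*=X^*_{>0}$. For $k=1,\dots,K$, given the density $f_{A_{\leq k-1}}(X_{<k},M_{R_{k-1}},X_k^*,X^*_{>k})$ (for $k\ge 2$ this is the marginal of the density obtained at step $k-1$, after summing out those indicators in $M_{R_{k-2}},M_{k-1}$ whose index is not in $R_{k-1}$), let $f_{A_{\leq k}}(X_k,M_k\mid X_{<k},M_{R_{k-1}},X^*_{>k})$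 be the conditional density that $A_k$ constructs from $f_{A_{\leq k-1}}(X_k^*\mid X_{<k},M_{R_{k-1}},X^*_{>k})$, and define $$f_{A_{\leq k}}(X_{\leq k},M_{R_{k-1}},M_k,X^*_{>k})=f_{A_{\leq k}}(X_k,M_k\mid X_{<k},M_{R_{k-1}},X^*_{>k})\,f_{A_{\leq k-1}}(X_{<k},M_{R_{k-1}},X^*_{>k}).$$ **Encoding.** A full-data density $\tilde f(X,M)$ encodes the assumptions $A_1,\dots,A_K$ (relative to $f(X^* )$) if for every $k=1,\dots,K$ the density it implies for $(X_{\leq k},M_{R_{k-1}},M_k,X^*_{>k})$ equals $f_{A_{\leq k}}(X_{\leq k},M_{R_{k-1}},M_k,X^*_{>k})$; that is, under $\tilde f$ the conditional distribution of $(X_k,M_k)$ given $(X_{<k},M_{R_{k-1}},X^*_{>k})$ is the one obtained by applying $A_k$ in the sequential construction above. *)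

theory Defs
  imports "HOL-Analysis.Analysis"
begin

text \<open>
  Variables are indexed by \<open>{1..p}\<close>. The sample space of the \<open>j\<close>-th variable is
  \<open>space (\<mu> j)\<close> with dominating measure \<open>\<mu> j\<close>, all inside one value type \<open>'a\<close>.
  An indicator \<open>m j = True\<close> means that variable \<open>j\<close> is missing. A materialized variable has type
  \<open>'a option\<close>, where \<open>None\<close> is the placeholder symbol. Densities are \<open>ennreal\<close>-valued functions,
  compared almost everywhere.
\<close>

text \<open>The measure \<open>N\<close> plus a unit point mass at the placeholder.\<close>

definition star_measure :: "'a measure \<Rightarrow> 'a option measure" where
  "star_measure N = measure_of (insert None (Some ` space N))
     {B. B \<subseteq> insert None (Some ` space N) \<and> Some -` B \<in> sets N}
     (\<lambda>B. emeasure N (Some -` B) + indicator B None)"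

definition mat_space :: "(nat \<Rightarrow> 'a measure) \<Rightarrow> nat set \<Rightarrow> (nat \<Rightarrow> 'a option) measure" where
  "mat_space \<mu> I = PiM I (\<lambda>j. star_measure (\<mu> j))"

definition ind_space :: "nat set \<Rightarrow> (nat \<Rightarrow> bool) measure" where
  "ind_space S = count_space (S \<rightarrow>\<^sub>E UNIV)"

definition full_space ::
  "(nat \<Rightarrow> 'a measure) \<Rightarrow> nat set \<Rightarrow> ((nat \<Rightarrow> 'a) \<times> (nat \<Rightarrow> bool)) measure" where
  "full_space \<mu> I = PiM I \<mu> \<Otimes>\<^sub>M ind_space I"

type_synonym 'a mixed = "(nat \<Rightarrow> 'a) \<times> (nat \<Rightarrow> bool) \<times> (nat \<Rightarrow> 'a option)"

text \<open>The space of \<open>(X\<^bsub>{1..a}\<^esub>, M\<^bsub>S\<^esub>, X*\<^bsub>{b<..p}\<^esub>)\<close>.\<close>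

definition mixed_space ::
  "(nat \<Rightarrow> 'a measure) \<Rightarrow> nat \<Rightarrow> nat \<Rightarrow> nat set \<Rightarrow> nat \<Rightarrow> 'a mixed measure" where
  "mixed_space \<mu> p a S b = PiM {1..a} \<mu> \<Otimes>\<^sub>M (ind_space S \<Otimes>\<^sub>M mat_space \<mu> {b<..p})"


definition is_density :: "'b measure \<Rightarrow> ('b \<Rightarrow> ennreal) \<Rightarrow> bool" where
  "is_density N f \<longleftrightarrow> f \<in> borel_measurable N \<and> (\<integral>\<^sup>+ y. f y \<partial>N) = 1"

text \<open>\<open>g c y\<close> stands for the conditional density \<open>g(y | c)\<close>, with \<open>c\<close> ranging over \<open>C\<close> and
  \<open>y\<close> over \<open>N\<close>.\<close>

definition is_cond_density ::
  "'c measure \<Rightarrow> 'b measure \<Rightarrow> ('c \<Rightarrow> 'b \<Rightarrow> ennreal) \<Rightarrow> bool" where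
  "is_cond_density C N g \<longleftrightarrow>
     (\<lambda>(c, y). g c y) \<in> borel_measurable (C \<Otimes>\<^sub>M N) \<and> (AE c in C. (\<integral>\<^sup>+ y. g c y \<partial>N) = 1)"

text \<open>\<open>g\<close> is a version of the conditional density belonging to the joint density \<open>h\<close>. Where the
  marginal density of \<open>c\<close> vanishes, any conditional density is allowed.\<close>

definition is_conditional_of ::
  "'c measure \<Rightarrow> 'b measure \<Rightarrow> ('c \<times> 'b \<Rightarrow> ennreal) \<Rightarrow> ('c \<Rightarrow> 'b \<Rightarrow> ennreal) \<Rightarrow> bool" where
  "is_conditional_of C N h g \<longleftrightarrow> is_cond_density C N g \<and>
     (AE (c, y) in C \<Otimes>\<^sub>M N. h (c, y) = g c y * (\<integral>\<^sup>+ z. h (c, z) \<partial>N))"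


text \<open>The density of the materialized variables with indices in \<open>I\<close> implied by a density \<open>h\<close> of
  \<open>(X\<^bsub>I\<^esub>, M\<^bsub>I\<^esub>)\<close>: the indicators and the observed entries are read off from \<open>xs\<close>, and the missing
  entries \<open>y\<close> are integrated out.\<close>

definition implied ::
  "(nat \<Rightarrow> 'a measure) \<Rightarrow> nat set \<Rightarrow> ((nat \<Rightarrow> 'a) \<times> (nat \<Rightarrow> bool) \<Rightarrow> ennreal) \<Rightarrow>
     (nat \<Rightarrow> 'a option) \<Rightarrow> ennreal" where
  "implied \<mu> I h xs =
     (\<integral>\<^sup>+ y. h (\<lambda>j\<in>I. case xs j of None \<Rightarrow> y j | Some v \<Rightarrow> v, \<lambda>j\<in>I. xs j = None)
        \<partial>PiM {j\<in>I. xs j = None} \<mu>)"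

text \<open>Sum out the indicators with index in \<open>S - R\<close>, for finite \<open>S\<close> and \<open>R \<subseteq> S\<close>.\<close>

definition keep_indicators ::
  "nat set \<Rightarrow> nat set \<Rightarrow> ('a mixed \<Rightarrow> ennreal) \<Rightarrow> 'a mixed \<Rightarrow> ennreal" where
  "keep_indicators S R F =
     (\<lambda>(x, m, xs). \<Sum>m' | m' \<in> S \<rightarrow>\<^sub>E UNIV \<and> restrict m' R = m. F (x, m', xs))"

text \<open>The density of \<open>(X\<^bsub>{1..b}\<^esub>, M\<^bsub>S\<^esub>, X*\<^bsub>{b<..p}\<^esub>)\<close> implied by a full-data density \<open>h\<close>.\<close>

definition implied_mixed ::
  "(nat \<Rightarrow> 'a measure) \<Rightarrow> nat \<Rightarrow> nat \<Rightarrow> nat set \<Rightarrow>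
     ((nat \<Rightarrow> 'a) \<times> (nat \<Rightarrow> bool) \<Rightarrow> ennreal) \<Rightarrow> 'a mixed \<Rightarrow> ennreal" where
  "implied_mixed \<mu> p b S h = keep_indicators {1..b} S
     (\<lambda>(x, m, xs). implied \<mu> {b<..p}
        (\<lambda>(y, n). h (merge {1..b} {b<..p} (x, y), merge {1..b} {b<..p} (m, n))) xs)"


definition block :: "(nat \<Rightarrow> nat) \<Rightarrow> nat \<Rightarrow> nat set" where
  "block t k = {t (k - 1)<..t k}"

text \<open>The space of the conditioning variables \<open>(X\<^bsub><k\<^esub>, M\<^bsub>R (k - 1)\<^esub>, X*\<^bsub>>k\<^esub>)\<close>.\<close>

definition given_space ::
  "(nat \<Rightarrow> 'a measure) \<Rightarrow> nat \<Rightarrow> (nat \<Rightarrow> nat) \<Rightarrow> (nat \<Rightarrow> nat set) \<Rightarrow> nat \<Rightarrow> 'a mixed measure" where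
  "given_space \<mu> p t R k = mixed_space \<mu> p (t (k - 1)) (R (k - 1)) (t k)"

text \<open>An identifying assumption for block \<open>k\<close>, as a rule \<open>Ak\<close> that sends conditional densities of
  \<open>X*\<^bsub>k\<^esub>\<close> to conditional densities of \<open>(X\<^bsub>k\<^esub>, M\<^bsub>k\<^esub>)\<close> implying the given ones.\<close>

definition identifying_assumption ::
  "(nat \<Rightarrow> 'a measure) \<Rightarrow> nat \<Rightarrow> (nat \<Rightarrow> nat) \<Rightarrow> (nat \<Rightarrow> nat set) \<Rightarrow> nat \<Rightarrow>
     (('a mixed \<Rightarrow> (nat \<Rightarrow> 'a option) \<Rightarrow> ennreal) \<Rightarrow>
      ('a mixed \<Rightarrow> (nat \<Rightarrow> 'a) \<times> (nat \<Rightarrow> bool) \<Rightarrow> ennreal)) \<Rightarrow> bool" where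
  "identifying_assumption \<mu> p t R k Ak \<longleftrightarrow>
     (\<forall>g. is_cond_density (given_space \<mu> p t R k) (mat_space \<mu> (block t k)) g \<longrightarrow>
        is_cond_density (given_space \<mu> p t R k) (full_space \<mu> (block t k)) (Ak g) \<and>
        (AE (c, xs) in given_space \<mu> p t R k \<Otimes>\<^sub>M mat_space \<mu> (block t k).
           implied \<mu> (block t k) (Ak g c) xs = g c xs))"

text \<open>\<open>D k h\<close> selects the version of the conditional density of \<open>X*\<^bsub>k\<^esub>\<close> given
  \<open>(X\<^bsub><k\<^esub>, M\<^bsub>R (k - 1)\<^esub>, X*\<^bsub>>k\<^esub>)\<close> for the joint density \<open>h\<close>, that is, it fixes the values left
  free by \<open>is_conditional_of\<close>. Such a selection always exists, see \<open>ex_version_choice\<close> below.\<close>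

definition version_choice ::
  "(nat \<Rightarrow> 'a measure) \<Rightarrow> nat \<Rightarrow> (nat \<Rightarrow> nat) \<Rightarrow> (nat \<Rightarrow> nat set) \<Rightarrow> nat \<Rightarrow>
     (nat \<Rightarrow> ('a mixed \<times> (nat \<Rightarrow> 'a option) \<Rightarrow> ennreal) \<Rightarrow>
        'a mixed \<Rightarrow> (nat \<Rightarrow> 'a option) \<Rightarrow> ennreal) \<Rightarrow> bool" where
  "version_choice \<mu> p t R K D \<longleftrightarrow>
     (\<forall>k\<in>{1..K}. \<forall>h.
        is_density (given_space \<mu> p t R k \<Otimes>\<^sub>M mat_space \<mu> (block t k)) h \<longrightarrow>
        is_conditional_of (given_space \<mu> p t R k) (mat_space \<mu> (block t k)) h (D k h))"

text \<open>The indices of the indicators in \<open>(M\<^bsub>R (k - 1)\<^esub>, M\<^bsub>k\<^esub>)\<close>; none for \<open>k = 0\<close>.\<close>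

definition step_inds :: "(nat \<Rightarrow> nat) \<Rightarrow> (nat \<Rightarrow> nat set) \<Rightarrow> nat \<Rightarrow> nat set" where
  "step_inds t R k = (if k = 0 then {} else R (k - 1) \<union> block t k)"

text \<open>Regard a density of \<open>(X\<^bsub><k\<^esub>, M\<^bsub>R (k - 1)\<^esub>, X*\<^bsub>k\<^esub>, X*\<^bsub>>k\<^esub>)\<close> as a joint density of the
  conditioning variables and \<open>X*\<^bsub>k\<^esub>\<close>.\<close>

definition split_block ::
  "nat \<Rightarrow> (nat \<Rightarrow> nat) \<Rightarrow> nat \<Rightarrow> ('a mixed \<Rightarrow> ennreal) \<Rightarrow>
     'a mixed \<times> (nat \<Rightarrow> 'a option) \<Rightarrow> ennreal" where
  "split_block p t k F = (\<lambda>((x, m, zs), ys). F (x, m, merge (block t k) {t k<..p} (ys, zs)))"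

text \<open>\<open>seq_density \<mu> p t R A D f k\<close> is the \<open>k\<close>-th sequentially identified density, a density of
  \<open>(X\<^bsub>{1..t k}\<^esub>, M\<^bsub>R (k - 1)\<^esub>, M\<^bsub>k\<^esub>, X*\<^bsub>>k\<^esub>)\<close>.\<close>

primrec seq_density ::
  "(nat \<Rightarrow> 'a measure) \<Rightarrow> nat \<Rightarrow> (nat \<Rightarrow> nat) \<Rightarrow> (nat \<Rightarrow> nat set) \<Rightarrow>
   (nat \<Rightarrow> ('a mixed \<Rightarrow> (nat \<Rightarrow> 'a option) \<Rightarrow> ennreal) \<Rightarrow>
      'a mixed \<Rightarrow> (nat \<Rightarrow> 'a) \<times> (nat \<Rightarrow> bool) \<Rightarrow> ennreal) \<Rightarrow>
   (nat \<Rightarrow> ('a mixed \<times> (nat \<Rightarrow> 'a option) \<Rightarrow> ennreal) \<Rightarrow>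
      'a mixed \<Rightarrow> (nat \<Rightarrow> 'a option) \<Rightarrow> ennreal) \<Rightarrow>
   ((nat \<Rightarrow> 'a option) \<Rightarrow> ennreal) \<Rightarrow> nat \<Rightarrow> 'a mixed \<Rightarrow> ennreal" where
  "seq_density \<mu> p t R A D f 0 = (\<lambda>(x, m, xs). f xs)"
| "seq_density \<mu> p t R A D f (Suc k) = (\<lambda>(x, m, xs).
     let h = split_block p t (Suc k)
               (keep_indicators (step_inds t R k) (R k) (seq_density \<mu> p t R A D f k));
         c = (restrict x {1..t k}, restrict m (R k), xs);
         B = block t (Suc k)
     in A (Suc k) (D (Suc k) h) c (restrict x B, restrict m B) *
        (\<integral>\<^sup>+ ys. h (c, ys) \<partial>mat_space \<mu> B))"

definition encodes ::
  "(nat \<Rightarrow> 'a measure) \<Rightarrow> nat \<Rightarrow> (nat \<Rightarrow> nat) \<Rightarrow> (nat \<Rightarrow> nat set) \<Rightarrow> nat \<Rightarrow>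
   (nat \<Rightarrow> ('a mixed \<Rightarrow> (nat \<Rightarrow> 'a option) \<Rightarrow> ennreal) \<Rightarrow>
      'a mixed \<Rightarrow> (nat \<Rightarrow> 'a) \<times> (nat \<Rightarrow> bool) \<Rightarrow> ennreal) \<Rightarrow>
   (nat \<Rightarrow> ('a mixed \<times> (nat \<Rightarrow> 'a option) \<Rightarrow> ennreal) \<Rightarrow>
      'a mixed \<Rightarrow> (nat \<Rightarrow> 'a option) \<Rightarrow> ennreal) \<Rightarrow>
   ((nat \<Rightarrow> 'a option) \<Rightarrow> ennreal) \<Rightarrow>
   ((nat \<Rightarrow> 'a) \<times> (nat \<Rightarrow> bool) \<Rightarrow> ennreal) \<Rightarrow> bool" where
  "encodes \<mu> p t R K A D f h \<longleftrightarrow>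
     (\<forall>k\<in>{1..K}. AE s in mixed_space \<mu> p (t k) (step_inds t R k) (t k).
        implied_mixed \<mu> p (t k) (step_inds t R k) h s = seq_density \<mu> p t R A D f k s)"

lemma sigma_algebra_star:
  "sigma_algebra (insert None (Some ` space N))
     {B. B \<subseteq> insert None (Some ` space N) \<and> Some -` B \<in> sets N}"
  (is "sigma_algebra ?O ?F")
proof -
  have compl: "Some -` (?O - B) = space N - Some -` B" for B
    by auto
  show ?thesis
    unfolding sigma_algebra_iff2
  proof (intro conjI ballI allI impI)
    fix B :: "nat \<Rightarrow> 'a option set"
    assume "range B \<subseteq> ?F"
    then have "Some -` B i \<in> sets N" and sub: "\<Union> (range B) \<subseteq> ?O" for i
      by blast+
    then have "(\<Union>i. Some -` B i) \<in> sets N"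
      by blast
    with sub show "\<Union> (range B) \<in> ?F"
      by (simp add: vimage_UN)
  qed (auto simp: compl)
qed

lemma space_star_measure: "space (star_measure N) = insert None (Some ` space N)"
  unfolding star_measure_def by (rule space_measure_of) auto

lemma sets_star_measure:
  "sets (star_measure N) = {B. B \<subseteq> insert None (Some ` space N) \<and> Some -` B \<in> sets N}"
  unfolding star_measure_def
  by (rule sigma_algebra.sets_measure_of_eq[OF sigma_algebra_star])

lemma emeasure_star_measure:
  assumes "B \<in> sets (star_measure N)"
  shows "emeasure (star_measure N) B = emeasure N (Some -` B) + indicator B None"
  unfolding star_measure_def
proof (rule emeasure_measure_of_sigma[OF sigma_algebra_star])
  let ?F = "{B. B \<subseteq> insert None (Some ` space N) \<and> Some -` B \<in> sets N}"
  show "positive ?F (\<lambda>B. emeasure N (Some -` B) + indicator B None)"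
    by (simp add: positive_def)
  show "countably_additive ?F (\<lambda>B. emeasure N (Some -` B) + indicator B None)"
  proof (rule countably_additiveI)
    fix B :: "nat \<Rightarrow> 'a option set"
    assume B: "range B \<subseteq> ?F" and d: "disjoint_family B"
    have "disjoint_family (\<lambda>i. Some -` B i)"
      using d unfolding disjoint_family_on_def by blast
    then have "(\<Sum>i. emeasure N (Some -` B i)) = emeasure N (\<Union>i. Some -` B i)"
      using B by (intro suminf_emeasure) auto
    moreover have "(\<Sum>i. indicator (B i) None :: ennreal) = indicator (\<Union>i. B i) None"
      by (rule suminf_indicator[OF d])
    ultimately show "(\<Sum>i. emeasure N (Some -` B i) + indicator (B i) None) =
        emeasure N (Some -` \<Union> (range B)) + indicator (\<Union> (range B)) None"
      by (simp add: vimage_UN suminf_add[symmetric])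
  qed
  show "B \<in> ?F"
    using assms by (simp add: sets_star_measure)
qed

lemma sigma_finite_star_measure:
  assumes "sigma_finite_measure N"
  shows "sigma_finite_measure (star_measure N)"
proof -
  interpret sigma_finite_measure N by fact
  obtain F where F: "countable F" "F \<subseteq> sets N" "\<Union>F = space N"
      "\<forall>a\<in>F. emeasure N a \<noteq> \<infinity>"
    using sigma_finite_countable by blast
  let ?G = "insert {None} ((`) Some ` F)"
  have vim: "Some -` (Some ` a) = a" for a :: "'a set"
    by auto
  have G: "a \<in> sets (star_measure N) \<and> emeasure (star_measure N) a \<noteq> \<infinity>" if a: "a \<in> ?G" for a
  proof (cases "a = {None}")
    case True
    then have a: "a \<in> sets (star_measure N)"
      by (simp add: sets_star_measure vimage_def)
    then show ?thesis
      using True by (simp add: emeasure_star_measure vimage_def)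
  next
    case False
    then obtain b where b: "b \<in> F" "a = Some ` b"
      using a by blast
    then have "b \<in> sets N" "b \<subseteq> space N"
      using F(2,3) by auto
    then have "a \<in> sets (star_measure N)"
      unfolding b sets_star_measure by (auto simp: vim)
    then show ?thesis
      using b F(4) by (auto simp: emeasure_star_measure vim)
  qed
  have "\<Union>?G = space (star_measure N)"
    unfolding space_star_measure F(3)[symmetric] by auto
  moreover have "countable ?G"
    using F(1) by simp
  moreover have "?G \<subseteq> sets (star_measure N)" "\<forall>a\<in>?G. emeasure (star_measure N) a \<noteq> \<infinity>"
    using G by blast+
  ultimately show ?thesis
    unfolding sigma_finite_measure_def by blast
qed

lemma product_sigma_finite_restrict:
  assumes "\<And>j. j \<in> I \<Longrightarrow> sigma_finite_measure (M j)"
  shows "product_sigma_finite (\<lambda>j. if j \<in> I then M j else count_space {})"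
  unfolding product_sigma_finite_def
  by (auto simp: assms sigma_finite_measure_count_space_finite)

lemma sigma_finite_PiM:
  assumes "finite I" and "\<And>j. j \<in> I \<Longrightarrow> sigma_finite_measure (M j)"
  shows "sigma_finite_measure (PiM I M)"
proof -
  have "PiM I M = PiM I (\<lambda>j. if j \<in> I then M j else count_space {})"
    by (rule PiM_cong) simp_all
  then show ?thesis
    using product_sigma_finite.sigma_finite[OF product_sigma_finite_restrict[OF assms(2)] assms(1)]
    by simp
qed

lemma sigma_finite_mat_space:
  assumes "finite I" and "\<And>j. j \<in> I \<Longrightarrow> sigma_finite_measure (\<mu> j)"
  shows "sigma_finite_measure (mat_space \<mu> I)"
  unfolding mat_space_def
  by (intro sigma_finite_PiM sigma_finite_star_measure assms)

lemma ex_density_mat_space: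
  assumes "finite I" and "\<And>j. j \<in> I \<Longrightarrow> sigma_finite_measure (\<mu> j)"
  shows "\<exists>d. is_density (mat_space \<mu> I) d"
proof -
  define N where "N = (\<lambda>j. if j \<in> I then star_measure (\<mu> j) else count_space {})"
  have N: "product_sigma_finite N"
    unfolding N_def
    by (intro product_sigma_finite_restrict sigma_finite_star_measure assms(2))
  have eq: "mat_space \<mu> I = PiM I N"
    unfolding mat_space_def by (rule PiM_cong) (simp_all add: N_def)
  let ?Z = "Pi\<^sub>E I (\<lambda>_. {None})"
  have none: "{None} \<in> sets (N j)" "emeasure (N j) {None} = 1" if "j \<in> I" for j
    using that by (simp_all add: N_def sets_star_measure emeasure_star_measure vimage_def)
  have Z: "?Z \<in> sets (PiM I N)"
    using assms(1) none(1) by (intro sets_PiM_I_finite)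
  have "emeasure (PiM I N) ?Z = (\<Prod>j\<in>I. emeasure (N j) {None})"
    using product_sigma_finite.emeasure_PiM[OF N assms(1), of "\<lambda>_. {None}"] none(1) by simp
  also have "\<dots> = 1"
    by (rule prod.neutral) (simp add: none(2))
  finally show ?thesis
    using Z by (intro exI[of _ "indicator ?Z"]) (simp add: is_density_def eq)
qed

lemma ex_is_conditional_of:
  assumes N: "sigma_finite_measure N" and C: "sigma_finite_measure C"
    and h: "is_density (C \<Otimes>\<^sub>M N) h" and d: "is_density N d"
  shows "\<exists>g. is_conditional_of C N h g"
proof -
  interpret pair_sigma_finite C N
    using N C by (simp add: pair_sigma_finite_def)
  have [measurable]: "h \<in> borel_measurable (C \<Otimes>\<^sub>M N)" "d \<in> borel_measurable N"
    and h1: "(\<integral>\<^sup>+ p. h p \<partial>(C \<Otimes>\<^sub>M N)) = 1" and d1: "(\<integral>\<^sup>+ y. d y \<partial>N) = 1"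
    using h d by (auto simp: is_density_def)
  define m where "m c = (\<integral>\<^sup>+ y. h (c, y) \<partial>N)" for c
  have m[measurable]: "m \<in> borel_measurable C"
    unfolding m_def by measurable
  define g where "g c y = (if m c = 0 \<or> m c = \<infinity> then d y else h (c, y) / m c)" for c y
  have g[measurable]: "(\<lambda>(c, y). g c y) \<in> borel_measurable (C \<Otimes>\<^sub>M N)"
    unfolding g_def by measurable
  have g1: "(\<integral>\<^sup>+ y. g c y \<partial>N) = 1" if "c \<in> space C" for c
  proof (cases "m c = 0 \<or> m c = \<infinity>")
    case False
    then have "(\<integral>\<^sup>+ y. g c y \<partial>N) = m c / m c"
      using that by (simp add: g_def m_def nn_integral_divide)
    then show ?thesis
      using False by (simp add: ennreal_divide_self less_top)
  qed (auto simp: g_def d1)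
  have "(\<integral>\<^sup>+ c. m c \<partial>C) = 1"
    using h1 by (simp add: m_def M2.nn_integral_fst)
  then have fin: "AE c in C. m c \<noteq> \<infinity>"
    by (intro nn_integral_PInf_AE) auto
  have "AE c in C. AE y in N. h (c, y) = g c y * m c"
    using fin AE_space
  proof eventually_elim
    case (elim c)
    show ?case
    proof (cases "m c = 0")
      case True
      then have "AE y in N. h (c, y) = 0"
        using elim by (subst (asm) m_def) (simp add: nn_integral_0_iff_AE)
      then show ?thesis
        by (simp add: True)
    next
      case False
      then show ?thesis
        using elim by (intro AE_I2) (auto simp: g_def ennreal_divide_times less_top)
    qed
  qed
  then have "AE p in C \<Otimes>\<^sub>M N. h p = g (fst p) (snd p) * m (fst p)"
    by (intro AE_pair_measure) (auto simp: case_prod_beta')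
  then show ?thesis
    using g g1 by (auto simp: is_conditional_of_def is_cond_density_def case_prod_beta' m_def
        intro!: exI[of _ g])
qed

lemma sigma_finite_mixed_space:
  assumes "finite S" and "a \<le> p" and sf: "\<And>j. j \<in> {1..p} \<Longrightarrow> sigma_finite_measure (\<mu> j)"
  shows "sigma_finite_measure (mixed_space \<mu> p a S b)"
proof -
  have "sigma_finite_measure (PiM {1..a} \<mu>)"
    using assms(2) by (intro sigma_finite_PiM sf) auto
  moreover have "sigma_finite_measure (ind_space S)"
    unfolding ind_space_def
    using assms(1) by (intro sigma_finite_measure_count_space_finite finite_PiE) auto
  moreover have "sigma_finite_measure (mat_space \<mu> {b<..p})"
    by (intro sigma_finite_mat_space sf) auto
  ultimately show ?thesis
    unfolding mixed_space_def
    by (intro sigma_finite_pair_measure)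
qed

lemma ex_version_choice:
  assumes sf: "\<And>j. j \<in> {1..p} \<Longrightarrow> sigma_finite_measure (\<mu> j)"
    and t: "\<And>k. k \<le> K \<Longrightarrow> t k \<le> p"
    and R: "\<And>k. k < K \<Longrightarrow> finite (R k)"
  shows "\<exists>D. version_choice \<mu> p t R K D"
proof -
  have ex: "\<exists>g. is_conditional_of (given_space \<mu> p t R k) (mat_space \<mu> (block t k)) h g"
    if k: "k \<in> {1..K}"
      and h: "is_density (given_space \<mu> p t R k \<Otimes>\<^sub>M mat_space \<mu> (block t k)) h" for k h
  proof -
    have tk: "t k \<le> p" "t (k - 1) \<le> p" and Rk: "finite (R (k - 1))"
      using k by (auto intro!: t R)
    have B: "finite (block t k)" "\<And>j. j \<in> block t k \<Longrightarrow> sigma_finite_measure (\<mu> j)"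
      using tk by (auto simp: block_def intro!: sf)
    obtain d where "is_density (mat_space \<mu> (block t k)) d"
      using ex_density_mat_space[of "block t k" \<mu>] B by blast
    moreover have "sigma_finite_measure (given_space \<mu> p t R k)"
      unfolding given_space_def by (rule sigma_finite_mixed_space[OF Rk tk(2) sf])
    ultimately show ?thesis
      using ex_is_conditional_of[OF sigma_finite_mat_space _ h] B by blast
  qed
  have "version_choice \<mu> p t R K (\<lambda>k h. SOME g.
      is_conditional_of (given_space \<mu> p t R k) (mat_space \<mu> (block t k)) h g)"
    unfolding version_choice_def by (intro ballI allI impI someI_ex[OF ex])
  then show ?thesis
    by blast
qed

end

theory Submission
  imports Defs
begin

text \<open>The density \<open>h\<close> is built by filling in the missing entries of one block at a time, while all the
  indicators are kept. Let \<open>G\<^sub>k\<close> be a density of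
  \<open>(X\<^bsub>{1..t k}\<^esub>, M\<^bsub>{1..t k}\<^esub>, X*\<^bsub>{t k<..p}\<^esub>)\<close>, with \<open>G\<^sub>0 = f\<close>. Write \<open>B\<close> for the next block,
  \<open>c\<close> for the variables that its assumption conditions on, \<open>g\<close> for the
  conditional density of \<open>X*\<^sub>B\<close> given \<open>c\<close> in the sequential construction, and \<open>q\<close> for the conditional
  density of \<open>(X\<^sub>B, M\<^sub>B)\<close> that the assumption makes of \<open>g\<close>. Since \<open>q\<close> implies \<open>g\<close>, the quotient
  \<open>q / g\<close> is a conditional density of the missing entries of \<open>X\<^sub>B\<close> given \<open>c\<close> and \<open>X*\<^sub>B\<close>. Put
  \<open>G\<^bsub>k+1\<^esub> = G\<^sub>k * (q / g)\<close>: given \<open>c\<close> and \<open>X*\<^sub>B\<close>, the missing entries are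
  drawn independently of the earlier indicators that \<open>c\<close> omits. Two things follow, both in \<open>extend_block\<close>.

  \<^item> Integrating the missing entries of block \<open>B\<close> out of \<open>G\<^bsub>k+1\<^esub>\<close> turns \<open>q\<close> into \<open>g\<close> and so gives back
    \<open>G\<^sub>k\<close>. Hence \<open>h = G\<^sub>K\<close> implies every \<open>G\<^sub>k\<close>, by downward induction on \<open>k\<close>, and \<open>G\<^sub>0 = f\<close> is the
    saturation property. It also makes \<open>h\<close> integrate to \<open>1\<close>.
  \<^item> Summing the indicators that \<open>c\<close> omits out of \<open>G\<^sub>k\<close> leaves, by induction, the density
    \<open>g * H\<close> of \<open>(c, X*\<^sub>B)\<close> from the sequential construction, where \<open>H\<close> is the density of \<open>c\<close>.
    Summing them out of \<open>G\<^bsub>k+1\<^esub>\<close> therefore leaves \<open>g * H * (q / g) = q * H\<close>, the next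
    sequentially identified density. So \<open>h\<close> encodes the assumptions.

  All identities hold almost everywhere only, and they live on different spaces. Two facts about
  the passage between \<open>(X, M)\<close> and \<open>X*\<close> make it possible to combine them: the integral of
  \<open>implied \<mu> I \<phi>\<close> is that of \<open>\<phi>\<close> (\<open>nn_integral_implied\<close>), and the map \<open>(X, M) \<mapsto> X*\<close> pulls null sets
  back to null sets (\<open>nonsingular_materialize\<close>). The value of \<open>q / g\<close> at zeros of \<open>g\<close> does not matter,
  because \<open>q\<close> and \<open>G\<^sub>k\<close> vanish almost everywhere there.\<close>

section \<open>Nonsingular and measure-preserving maps\<close>

text \<open>Pulling back null sets is exactly what transports almost-everywhere statements. The map
  \<open>(X, M) \<mapsto> X*\<close> is of this kind but does not preserve measure, since it forgets the missing entries,
  whose sample spaces may have any total mass.\<close>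
definition nonsingular_map :: "'b measure \<Rightarrow> 'c measure \<Rightarrow> ('b \<Rightarrow> 'c) \<Rightarrow> bool" where
  "nonsingular_map M N \<phi> \<longleftrightarrow> \<phi> \<in> M \<rightarrow>\<^sub>M N \<and> (\<forall>A\<in>null_sets N. AE x in M. \<phi> x \<notin> A)"

lemma nonsingular_mapI:
  assumes \<phi>: "\<phi> \<in> M \<rightarrow>\<^sub>M N"
    and "\<And>F. F \<in> borel_measurable N \<Longrightarrow> (\<integral>\<^sup>+ y. F y \<partial>N) = 0 \<Longrightarrow> (\<integral>\<^sup>+ x. F (\<phi> x) \<partial>M) = (0::ennreal)"
  shows "nonsingular_map M N \<phi>"
  unfolding nonsingular_map_def
proof (intro conjI ballI)
  fix A assume A: "A \<in> null_sets N"
  then have "(\<integral>\<^sup>+ x. indicator A (\<phi> x) \<partial>M) = (0::ennreal)"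
    by (intro assms(2)) (auto simp: null_sets_def)
  moreover have "(\<lambda>x. indicator A (\<phi> x) :: ennreal) \<in> borel_measurable M"
    using A \<phi> by (intro measurable_compose[OF \<phi>]) auto
  ultimately have "AE x in M. indicator A (\<phi> x) = (0::ennreal)"
    by (simp add: nn_integral_0_iff_AE)
  then show "AE x in M. \<phi> x \<notin> A"
    by (simp add: indicator_def)
qed fact

lemma nonsingular_map_measurable: "nonsingular_map M N \<phi> \<Longrightarrow> \<phi> \<in> M \<rightarrow>\<^sub>M N"
  by (simp add: nonsingular_map_def)

lemma AE_nonsingular_map:
  assumes "nonsingular_map M N \<phi>" and "AE y in N. P y"
  shows "AE x in M. P (\<phi> x)"
proof -
  obtain A where A: "{y \<in> space N. \<not> P y} \<subseteq> A" "A \<in> null_sets N"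
    using assms(2) by (auto simp: eventually_ae_filter)
  have "AE x in M. \<phi> x \<notin> A"
    using assms(1) A(2) by (auto simp: nonsingular_map_def)
  then show ?thesis
    using AE_space
  proof eventually_elim
    case (elim x)
    then show ?case
      using A(1) measurable_space[OF nonsingular_map_measurable[OF assms(1)], of x] by blast
  qed
qed

lemma nonsingular_map_id: "nonsingular_map M M (\<lambda>x. x)"
  by (rule nonsingular_mapI) auto

lemma nonsingular_map_count_space:
  assumes "\<And>x. x \<in> F \<Longrightarrow> \<phi> x \<in> G"
  shows "nonsingular_map (count_space F) (count_space G) \<phi>"
  using assms by (auto simp: nonsingular_map_def null_sets_count_space)

lemma nonsingular_map_pair:
  assumes \<phi>: "nonsingular_map M N \<phi>" and \<psi>: "nonsingular_map M' N' \<psi>"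
    and sf: "sigma_finite_measure M'" "sigma_finite_measure N" "sigma_finite_measure N'"
  shows "nonsingular_map (M \<Otimes>\<^sub>M M') (N \<Otimes>\<^sub>M N') (\<lambda>(x, y). (\<phi> x, \<psi> y))"
proof (rule nonsingular_mapI)
  note [measurable] = nonsingular_map_measurable[OF \<phi>] nonsingular_map_measurable[OF \<psi>]
  interpret M': sigma_finite_measure M' by fact
  interpret N: sigma_finite_measure N by fact
  interpret N': sigma_finite_measure N' by fact
  show "(\<lambda>(x, y). (\<phi> x, \<psi> y)) \<in> M \<Otimes>\<^sub>M M' \<rightarrow>\<^sub>M N \<Otimes>\<^sub>M N'"
    by measurable
  fix F :: "_ \<Rightarrow> ennreal"
  assume F[measurable]: "F \<in> borel_measurable (N \<Otimes>\<^sub>M N')" and 0: "(\<integral>\<^sup>+ z. F z \<partial>(N \<Otimes>\<^sub>M N')) = 0"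
  from 0 have "AE x in N. (\<integral>\<^sup>+ y. F (x, y) \<partial>N') = 0"
    by (subst nn_integral_0_iff_AE[symmetric]) (simp_all add: N'.nn_integral_fst)
  then have "AE x in N. AE y in N'. F (x, y) = 0"
    using AE_space by eventually_elim (simp add: nn_integral_0_iff_AE)
  then have "AE x in N. AE y in M'. F (x, \<psi> y) = 0"
    by eventually_elim (rule AE_nonsingular_map[OF \<psi>])
  then have "AE x in M. AE y in M'. F (\<phi> x, \<psi> y) = 0"
    by (rule AE_nonsingular_map[OF \<phi>])
  then have "AE x in M. (\<integral>\<^sup>+ y. F (\<phi> x, \<psi> y) \<partial>M') = 0"
    using AE_space by eventually_elim (simp add: nn_integral_0_iff_AE measurable_space[OF nonsingular_map_measurable[OF \<phi>]])
  then have "(\<integral>\<^sup>+ x. \<integral>\<^sup>+ y. F (\<phi> x, \<psi> y) \<partial>M' \<partial>M) = 0"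
    by (subst nn_integral_0_iff_AE) simp_all
  then show "(\<integral>\<^sup>+ z. F ((\<lambda>(x, y). (\<phi> x, \<psi> y)) z) \<partial>(M \<Otimes>\<^sub>M M')) = 0"
    by (subst M'.nn_integral_fst[symmetric]) simp_all
qed

definition measure_preserving :: "'b measure \<Rightarrow> 'c measure \<Rightarrow> ('b \<Rightarrow> 'c) \<Rightarrow> bool" where
  "measure_preserving M N \<phi> \<longleftrightarrow> \<phi> \<in> M \<rightarrow>\<^sub>M N \<and> distr M N \<phi> = N"

lemma measure_preservingI:
  assumes \<phi>: "\<phi> \<in> M \<rightarrow>\<^sub>M N"
    and int: "\<And>F. F \<in> borel_measurable N \<Longrightarrow> (\<integral>\<^sup>+ x. F (\<phi> x) \<partial>M) = (\<integral>\<^sup>+ y. F y \<partial>N :: ennreal)"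
  shows "measure_preserving M N \<phi>"
  unfolding measure_preserving_def
proof (intro conjI measure_eqI)
  fix A assume "A \<in> sets (distr M N \<phi>)"
  then have A: "A \<in> sets N"
    by simp
  then have "emeasure (distr M N \<phi>) A = (\<integral>\<^sup>+ y. indicator A y \<partial>distr M N \<phi>)"
    by simp
  also have "\<dots> = (\<integral>\<^sup>+ x. indicator A (\<phi> x) \<partial>M)"
    using A \<phi> by (intro nn_integral_distr) auto
  also have "\<dots> = emeasure N A"
    using A by (subst int) auto
  finally show "emeasure (distr M N \<phi>) A = emeasure N A" .
qed (use \<phi> in auto)

lemma measure_preserving_measurable: "measure_preserving M N \<phi> \<Longrightarrow> \<phi> \<in> M \<rightarrow>\<^sub>M N"
  by (simp add: measure_preserving_def)

lemma nn_integral_measure_preserving: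
  assumes "measure_preserving M N \<phi>" and "F \<in> borel_measurable N"
  shows "(\<integral>\<^sup>+ x. F (\<phi> x) \<partial>M) = (\<integral>\<^sup>+ y. F y \<partial>N)"
  using nn_integral_distr[of \<phi> M N F] assms by (auto simp: measure_preserving_def)

lemma measure_preserving_nonsingular: "measure_preserving M N \<phi> \<Longrightarrow> nonsingular_map M N \<phi>"
  by (auto intro: nonsingular_mapI simp: nn_integral_measure_preserving measure_preserving_measurable)

lemma measure_preserving_inverse:
  assumes \<phi>: "measure_preserving M N \<phi>" and \<theta>: "\<theta> \<in> N \<rightarrow>\<^sub>M M"
    and inv: "\<And>x. x \<in> space M \<Longrightarrow> \<theta> (\<phi> x) = x"
  shows "measure_preserving N M \<theta>"
proof (rule measure_preservingI[OF \<theta>])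
  fix F :: "_ \<Rightarrow> ennreal" assume F: "F \<in> borel_measurable M"
  have "(\<integral>\<^sup>+ y. F (\<theta> y) \<partial>N) = (\<integral>\<^sup>+ x. F (\<theta> (\<phi> x)) \<partial>M)"
    using F \<theta> by (intro nn_integral_measure_preserving[OF \<phi>, symmetric]) simp
  then show "(\<integral>\<^sup>+ y. F (\<theta> y) \<partial>N) = (\<integral>\<^sup>+ x. F x \<partial>M)"
    by (simp add: inv cong: nn_integral_cong)
qed

lemma AE_measure_preserving_iff:
  assumes \<phi>: "measure_preserving M N \<phi>" and \<theta>: "\<theta> \<in> N \<rightarrow>\<^sub>M M"
    and inv: "\<And>x. x \<in> space M \<Longrightarrow> \<theta> (\<phi> x) = x" "\<And>y. y \<in> space N \<Longrightarrow> \<phi> (\<theta> y) = y"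
  shows "(AE y in N. P y) \<longleftrightarrow> (AE x in M. P (\<phi> x))"
proof
  assume "AE y in N. P y"
  then show "AE x in M. P (\<phi> x)"
    by (rule AE_nonsingular_map[OF measure_preserving_nonsingular[OF \<phi>]])
next
  assume "AE x in M. P (\<phi> x)"
  with measure_preserving_nonsingular[OF measure_preserving_inverse[OF \<phi> \<theta> inv(1)]]
  have "AE y in N. P (\<phi> (\<theta> y))"
    by (rule AE_nonsingular_map)
  then show "AE y in N. P y"
    using AE_space by eventually_elim (simp add: inv(2))
qed

section \<open>Finite products of \<sigma>-finite measures\<close>

text \<open>Only the measures with index in \<open>I \<union> J\<close> are known to be \<open>\<sigma>\<close>-finite, whereas \<open>product_sigma_finite\<close>
  wants all of them to be. The remaining ones are replaced by the null measure on the empty space.\<close>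
lemma nn_integral_PiM_union:
  assumes "I \<inter> J = {}" "finite I" "finite J"
    and sf: "\<And>j. j \<in> I \<union> J \<Longrightarrow> sigma_finite_measure (M j)"
    and F: "F \<in> borel_measurable (PiM (I \<union> J) M)"
  shows "(\<integral>\<^sup>+ x. F x \<partial>PiM (I \<union> J) M) = (\<integral>\<^sup>+ x. \<integral>\<^sup>+ y. F (merge I J (x, y)) \<partial>PiM J M \<partial>PiM I M)"
proof -
  define M' where "M' j = (if j \<in> I \<union> J then M j else count_space {})" for j
  interpret product_sigma_finite M'
    unfolding M'_def by (rule product_sigma_finite_restrict[OF sf])
  have eq: "PiM I M = PiM I M'" "PiM J M = PiM J M'" "PiM (I \<union> J) M = PiM (I \<union> J) M'"
    by (auto intro!: PiM_cong simp: M'_def)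
  show ?thesis
    using product_nn_integral_fold[OF assms(1-3), of F] F unfolding eq by simp
qed

lemma nn_integral_PiM_insert:
  assumes "finite I" "i \<notin> I"
    and sf: "\<And>j. j \<in> insert i I \<Longrightarrow> sigma_finite_measure (M j)"
    and F: "F \<in> borel_measurable (PiM (insert i I) M)"
  shows "(\<integral>\<^sup>+ x. F x \<partial>PiM (insert i I) M) = (\<integral>\<^sup>+ x. \<integral>\<^sup>+ y. F (x(i := y)) \<partial>M i \<partial>PiM I M)"
proof -
  define M' where "M' j = (if j \<in> insert i I then M j else count_space {})" for j
  interpret product_sigma_finite M'
    unfolding M'_def by (rule product_sigma_finite_restrict[OF sf])
  have eq: "PiM I M = PiM I M'" "M i = M' i" "PiM (insert i I) M = PiM (insert i I) M'"
    by (auto intro!: PiM_cong simp: M'_def)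
  show ?thesis
    using product_nn_integral_insert[OF assms(1-2), of F] F unfolding eq by simp
qed

section \<open>Integration over materialized variables\<close>

lemma measurable_Some_star[measurable]: "Some \<in> N \<rightarrow>\<^sub>M star_measure N"
  by (rule measurableI) (auto simp: space_star_measure sets_star_measure Int_absorb2 dest: sets.sets_into_space)

lemma None_in_space_star[simp]: "None \<in> space (star_measure N)"
  by (simp add: space_star_measure)

lemma nn_integral_star_measure:
  assumes "F \<in> borel_measurable (star_measure N)"
  shows "(\<integral>\<^sup>+ y. F y \<partial>star_measure N) = (\<integral>\<^sup>+ v. F (Some v) \<partial>N) + F None"
  using assms
proof (induct rule: borel_measurable_induct)
  case (cong f g)
  have "(\<integral>\<^sup>+ v. f (Some v) \<partial>N) = (\<integral>\<^sup>+ v. g (Some v) \<partial>N)"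
    using cong(3) by (intro nn_integral_cong) (simp add: space_star_measure)
  then show ?case
    using cong(3,4) nn_integral_cong[of "star_measure N" f g] by simp
next
  case (set B)
  have "(\<integral>\<^sup>+ v. indicator B (Some v) \<partial>N) = (\<integral>\<^sup>+ v. indicator (Some -` B) v \<partial>N)"
    by (intro nn_integral_cong) (auto simp: indicator_def)
  then show ?case
    using set by (simp add: emeasure_star_measure) (simp add: sets_star_measure)
next
  case (mult u c)
  have "u \<in> borel_measurable (star_measure N)" "(\<lambda>v. u (Some v)) \<in> borel_measurable N"
    using mult by auto
  then show ?case
    using mult by (simp add: nn_integral_cmult distrib_left)
next
  case (add u v)
  have [measurable]: "u \<in> borel_measurable (star_measure N)" "v \<in> borel_measurable (star_measure N)"
    using add by auto
  show ?case
    using add by (simp add: nn_integral_add ac_simps)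
next
  case (seq U)
  have [measurable]: "\<And>i. U i \<in> borel_measurable (star_measure N)"
    using seq by auto
  have S: "(SUP i. U i) x = (SUP i. U i x)" for x
    by (simp add: image_comp)
  have inc: "incseq (\<lambda>i v. U i (Some v))" "incseq (\<lambda>i. U i x)" for x
    using seq by (auto simp: mono_def le_fun_def)
  have "(\<integral>\<^sup>+ y. (SUP i. U i) y \<partial>star_measure N) = (SUP i. \<integral>\<^sup>+ y. U i y \<partial>star_measure N)"
    unfolding S using seq by (intro nn_integral_monotone_convergence_SUP) auto
  also have "\<dots> = (SUP i. (\<integral>\<^sup>+ v. U i (Some v) \<partial>N) + U i None)"
    using seq by simp
  also have "\<dots> = (SUP i. \<integral>\<^sup>+ v. U i (Some v) \<partial>N) + (SUP i. U i None)"
    using inc by (intro ennreal_SUP_add) (auto simp: mono_def le_fun_def intro!: nn_integral_mono)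
  also have "(SUP i. \<integral>\<^sup>+ v. U i (Some v) \<partial>N) = (\<integral>\<^sup>+ v. (SUP i. U i (Some v)) \<partial>N)"
    using inc by (intro nn_integral_monotone_convergence_SUP[symmetric]) auto
  finally show ?case
    unfolding S .
qed

text \<open>The map \<open>(X, M) \<mapsto> X*\<close> on the variables with index in \<open>I\<close>.\<close>
definition materialize :: "nat set \<Rightarrow> (nat \<Rightarrow> 'a) \<times> (nat \<Rightarrow> bool) \<Rightarrow> nat \<Rightarrow> 'a option" where
  "materialize I = (\<lambda>(x, m). \<lambda>j\<in>I. if m j then None else Some (x j))"

abbreviation missing :: "nat set \<Rightarrow> (nat \<Rightarrow> 'a option) \<Rightarrow> nat set" where
  "missing I xs \<equiv> {j \<in> I. xs j = None}"

text \<open>The point of \<open>(X, M)\<close>-space with materialized values \<open>xs\<close> and missing entries \<open>y\<close>, that is, the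
  argument of the integrand in \<open>implied\<close>.\<close>
definition fill :: "nat set \<Rightarrow> (nat \<Rightarrow> 'a option) \<Rightarrow> (nat \<Rightarrow> 'a) \<Rightarrow> (nat \<Rightarrow> 'a) \<times> (nat \<Rightarrow> bool)" where
  "fill I xs y = (\<lambda>j\<in>I. case xs j of None \<Rightarrow> y j | Some v \<Rightarrow> v, \<lambda>j\<in>I. xs j = None)"

lemma implied_fill: "implied \<mu> I h xs = (\<integral>\<^sup>+ y. h (fill I xs y) \<partial>PiM (missing I xs) \<mu>)"
  by (simp add: implied_def fill_def)

text \<open>As a product space, \<open>ind_space\<close> is covered by the results on merging coordinates.\<close>
lemma ind_space_eq_PiM: "finite S \<Longrightarrow> ind_space S = PiM S (\<lambda>_. count_space UNIV)"
  unfolding ind_space_def by (subst count_space_PiM_finite) auto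

lemma space_ind_space: "space (ind_space S) = S \<rightarrow>\<^sub>E UNIV"
  by (simp add: ind_space_def)

lemma measurable_ind_space: "f \<in> ind_space S \<rightarrow>\<^sub>M N \<longleftrightarrow> f \<in> (S \<rightarrow>\<^sub>E UNIV) \<rightarrow> space N"
  by (simp add: ind_space_def)

lemma measurable_indicator_entry[measurable]: "(\<lambda>m. m j) \<in> ind_space S \<rightarrow>\<^sub>M count_space UNIV"
  by (simp add: measurable_ind_space)

lemma finite_patterns: "finite S \<Longrightarrow> finite (S \<rightarrow>\<^sub>E (UNIV :: bool set))"
  by (intro finite_PiE) auto

lemma nn_integral_ind_space:
  "finite S \<Longrightarrow> (\<integral>\<^sup>+ m. F m \<partial>ind_space S) = (\<Sum>m\<in>S \<rightarrow>\<^sub>E UNIV. F m)"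
  by (simp add: ind_space_def nn_integral_count_space_finite finite_patterns)

lemma sigma_finite_ind_space: "finite S \<Longrightarrow> sigma_finite_measure (ind_space S)"
  unfolding ind_space_def by (intro sigma_finite_measure_count_space_finite finite_patterns)

lemma sigma_finite_full_space:
  assumes "finite I" and "\<And>j. j \<in> I \<Longrightarrow> sigma_finite_measure (\<mu> j)"
  shows "sigma_finite_measure (full_space \<mu> I)"
  unfolding full_space_def
  by (intro sigma_finite_pair_measure sigma_finite_PiM sigma_finite_ind_space assms)

lemma nn_integral_full_space:
  assumes "finite I" and "\<And>j. j \<in> I \<Longrightarrow> sigma_finite_measure (\<mu> j)"
    and F: "F \<in> borel_measurable (full_space \<mu> I)"
  shows "(\<integral>\<^sup>+ n. F n \<partial>full_space \<mu> I) = (\<Sum>m\<in>I \<rightarrow>\<^sub>E UNIV. \<integral>\<^sup>+ x. F (x, m) \<partial>PiM I \<mu>)"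
proof -
  interpret ind: sigma_finite_measure "ind_space I"
    by (rule sigma_finite_ind_space) fact
  have [measurable]: "F \<in> borel_measurable (PiM I \<mu> \<Otimes>\<^sub>M ind_space I)"
    using F by (simp add: full_space_def)
  have "(\<integral>\<^sup>+ n. F n \<partial>full_space \<mu> I) = (\<integral>\<^sup>+ x. (\<Sum>m\<in>I \<rightarrow>\<^sub>E UNIV. F (x, m)) \<partial>PiM I \<mu>)"
    unfolding full_space_def
    by (subst ind.nn_integral_fst[symmetric]) (simp_all add: nn_integral_ind_space assms)
  also have "\<dots> = (\<Sum>m\<in>I \<rightarrow>\<^sub>E UNIV. \<integral>\<^sup>+ x. F (x, m) \<partial>PiM I \<mu>)"
  proof (rule nn_integral_sum)
    fix m :: "nat \<Rightarrow> bool" assume m: "m \<in> I \<rightarrow>\<^sub>E UNIV"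
    have "(\<lambda>x. (x, m)) \<in> PiM I \<mu> \<rightarrow>\<^sub>M PiM I \<mu> \<Otimes>\<^sub>M ind_space I"
      using m by (intro measurable_Pair measurable_ident_sets measurable_const) (auto simp: space_ind_space)
    then show "(\<lambda>x. F (x, m)) \<in> borel_measurable (PiM I \<mu>)"
      by (rule measurable_compose) measurable
  qed
  finally show ?thesis .
qed

lemma materialize_measurable[measurable]: "materialize I \<in> full_space \<mu> I \<rightarrow>\<^sub>M mat_space \<mu> I"
  unfolding materialize_def full_space_def mat_space_def split_beta' by measurable

lemma materialize_pattern_measurable:
  "(\<lambda>x. materialize I (x, m)) \<in> PiM {j\<in>I. \<not> m j} \<mu> \<rightarrow>\<^sub>M mat_space \<mu> I"
  unfolding materialize_def mat_space_def split
proof (rule measurable_restrict)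
  fix j assume "j \<in> I"
  then show "(\<lambda>x. if m j then None else Some (x j)) \<in> PiM {j \<in> I. \<not> m j} \<mu> \<rightarrow>\<^sub>M star_measure (\<mu> j)"
    by (cases "m j") (auto intro!: measurable_compose[OF measurable_component_singleton measurable_Some_star])
qed

text \<open>Each factor of \<open>mat_space\<close> is the sum of \<open>\<mu> j\<close> and a point mass. Multiplying out gives one term per
  missingness pattern \<open>m\<close>, in which only the observed variables are integrated over.\<close>
lemma nn_integral_mat_space:
  assumes "finite I" and "\<And>j. j \<in> I \<Longrightarrow> sigma_finite_measure (\<mu> j)"
    and "F \<in> borel_measurable (mat_space \<mu> I)"
  shows "(\<integral>\<^sup>+ xs. F xs \<partial>mat_space \<mu> I) =
    (\<Sum>m\<in>I \<rightarrow>\<^sub>E UNIV. \<integral>\<^sup>+ x. F (materialize I (x, m)) \<partial>PiM {j\<in>I. \<not> m j} \<mu>)"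
  using assms
proof (induction I arbitrary: F rule: finite_induct)
  case empty
  show ?case
    by (simp add: mat_space_def PiM_empty nn_integral_count_space_finite materialize_def)
next
  case (insert i I)
  let ?G = "\<lambda>ys. (\<integral>\<^sup>+ v. F (ys(i := Some v)) \<partial>\<mu> i) + F (ys(i := None))"
  let ?H = "\<lambda>m. \<integral>\<^sup>+ x. F (materialize (insert i I) (x, m)) \<partial>PiM {j\<in>insert i I. \<not> m j} \<mu>"
  interpret i: sigma_finite_measure "\<mu> i"
    using insert by simp
  have F[measurable]: "F \<in> borel_measurable (PiM (insert i I) (\<lambda>j. star_measure (\<mu> j)))"
    using insert.prems(2) by (simp add: mat_space_def)
  have upd: "(\<lambda>ys. F (ys(i := None))) \<in> borel_measurable (mat_space \<mu> I)"
    "(\<lambda>(ys, v). F (ys(i := Some v))) \<in> borel_measurable (mat_space \<mu> I \<Otimes>\<^sub>M \<mu> i)"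
    unfolding mat_space_def by measurable
  note [measurable] = upd
  have star: "(\<lambda>v. F (ys(i := v))) \<in> borel_measurable (star_measure (\<mu> i))"
    if "ys \<in> space (mat_space \<mu> I)" for ys
    using that insert.hyps(2) F
    by (intro measurable_compose[OF measurable_component_update F]) (simp add: mat_space_def)
  have "(\<integral>\<^sup>+ xs. F xs \<partial>mat_space \<mu> (insert i I)) =
      (\<integral>\<^sup>+ ys. \<integral>\<^sup>+ y. F (ys(i := y)) \<partial>star_measure (\<mu> i) \<partial>mat_space \<mu> I)"
    unfolding mat_space_def using insert
    by (intro nn_integral_PiM_insert sigma_finite_star_measure) auto
  also have "\<dots> = (\<integral>\<^sup>+ ys. ?G ys \<partial>mat_space \<mu> I)"
    by (intro nn_integral_cong nn_integral_star_measure star)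
  also have "\<dots> = (\<Sum>m\<in>I \<rightarrow>\<^sub>E UNIV. \<integral>\<^sup>+ x. ?G (materialize I (x, m)) \<partial>PiM {j\<in>I. \<not> m j} \<mu>)"
  proof (rule insert.IH)
    show "?G \<in> borel_measurable (mat_space \<mu> I)"
      by measurable
  qed (use insert.prems(1) in simp)
  also have "\<dots> = (\<Sum>m\<in>I \<rightarrow>\<^sub>E UNIV. ?H (m(i := False)) + ?H (m(i := True)))"
  proof (rule sum.cong[OF refl])
    fix m :: "nat \<Rightarrow> bool" assume m: "m \<in> I \<rightarrow>\<^sub>E UNIV"
    have sets: "{j \<in> insert i I. \<not> (m(i := True)) j} = {j \<in> I. \<not> m j}"
      "{j \<in> insert i I. \<not> (m(i := False)) j} = insert i {j \<in> I. \<not> m j}"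
      using insert.hyps(2) by auto
    have mat: "materialize (insert i I) (x, m(i := True)) = (materialize I (x, m))(i := None)"
      "materialize (insert i I) (x(i := v), m(i := False)) = (materialize I (x, m))(i := Some v)"
      for x :: "nat \<Rightarrow> 'a" and v
      using insert.hyps(2) by (auto simp: materialize_def restrict_def fun_eq_iff)
    have [measurable]: "(\<lambda>x. materialize I (x, m)) \<in> PiM {j \<in> I. \<not> m j} \<mu> \<rightarrow>\<^sub>M mat_space \<mu> I"
      by (rule materialize_pattern_measurable)
    have "(\<lambda>x. F (materialize (insert i I) (x, m(i := False))))
        \<in> borel_measurable (PiM (insert i {j \<in> I. \<not> m j}) \<mu>)"
      using measurable_compose[OF materialize_pattern_measurable[of "insert i I" "m(i := False)"] insert.prems(2)]
      by (simp only: sets)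
    then have "?H (m(i := False)) =
        (\<integral>\<^sup>+ x. \<integral>\<^sup>+ v. F ((materialize I (x, m))(i := Some v)) \<partial>\<mu> i \<partial>PiM {j \<in> I. \<not> m j} \<mu>)"
      unfolding sets mat(2)[symmetric] using insert
      by (intro nn_integral_PiM_insert) auto
    then show "(\<integral>\<^sup>+ x. ?G (materialize I (x, m)) \<partial>PiM {j\<in>I. \<not> m j} \<mu>) =
        ?H (m(i := False)) + ?H (m(i := True))"
      unfolding sets mat(1) by (simp add: nn_integral_add)
  qed
  also have "\<dots> = (\<Sum>(b, m)\<in>UNIV \<times> (I \<rightarrow>\<^sub>E UNIV). ?H (m(i := b)))"
    by (simp add: sum.cartesian_product[symmetric] UNIV_bool sum.distrib)
  also have "\<dots> = (\<Sum>m\<in>insert i I \<rightarrow>\<^sub>E UNIV. ?H m)"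
    unfolding PiE_insert_eq
    using insert.hyps(2)
    by (subst sum.reindex[OF inj_combinator]) (auto intro!: sum.cong)
  finally show ?case .
qed

lemma fill_materialize:
  assumes "m \<in> I \<rightarrow>\<^sub>E UNIV"
  shows "missing I (materialize I (x, m)) = {j\<in>I. m j}"
    and "fill I (materialize I (x, m)) y = (merge {j\<in>I. \<not> m j} {j\<in>I. m j} (x, y), m)"
  using assms
  by (auto simp: materialize_def fill_def merge_def fun_eq_iff restrict_def PiE_def extensional_def)

lemma materialize_fill: "xs \<in> extensional I \<Longrightarrow> materialize I (fill I xs y) = xs"
  by (auto simp: materialize_def fill_def fun_eq_iff restrict_def extensional_def split: option.split)

lemma in_space_mat_space:
  "xs \<in> space (mat_space \<mu> I) \<longleftrightarrow>
    xs \<in> extensional I \<and> (\<forall>j\<in>I. \<forall>v. xs j = Some v \<longrightarrow> v \<in> space (\<mu> j))"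
proof -
  have "y \<in> space (star_measure N) \<longleftrightarrow> (\<forall>v. y = Some v \<longrightarrow> v \<in> space N)" for y and N :: "'a measure"
    by (cases y) (auto simp: space_star_measure)
  then show ?thesis
    by (auto simp: mat_space_def space_PiM PiE_def Pi_def)
qed

lemma fill_measurable:
  assumes "xs \<in> space (mat_space \<mu> I)"
  shows "fill I xs \<in> PiM (missing I xs) \<mu> \<rightarrow>\<^sub>M full_space \<mu> I"
  unfolding fill_def full_space_def
proof (intro measurable_Pair measurable_restrict measurable_const)
  fix j assume "j \<in> I"
  then show "(\<lambda>y. case xs j of None \<Rightarrow> y j | Some v \<Rightarrow> v) \<in> PiM (missing I xs) \<mu> \<rightarrow>\<^sub>M \<mu> j"
    using assms by (cases "xs j") (auto simp: in_space_mat_space)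
qed (auto simp: space_ind_space)

text \<open>The default value lies in the sample space, if there is any, so that the function is measurable
  even though \<open>the\<close> is not.\<close>
definition observed_value :: "'a measure \<Rightarrow> 'a option \<Rightarrow> 'a" where
  "observed_value N y = (case y of None \<Rightarrow> SOME v. v \<in> space N | Some v \<Rightarrow> v)"

lemma observed_value_measurable:
  assumes "space N \<noteq> {}"
  shows "observed_value N \<in> star_measure N \<rightarrow>\<^sub>M N"
proof (rule measurableI)
  show "observed_value N y \<in> space N" if "y \<in> space (star_measure N)" for y
    using that assms by (auto simp: space_star_measure observed_value_def intro: someI)
  show "observed_value N -` A \<inter> space (star_measure N) \<in> sets (star_measure N)" if "A \<in> sets N" for A
  proof -
    have "Some -` (observed_value N -` A \<inter> space (star_measure N)) = A \<inter> space N"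
      by (auto simp: observed_value_def space_star_measure)
    then show ?thesis
      using that unfolding sets_star_measure by (auto simp: space_star_measure)
  qed
qed

lemma measurable_is_placeholder[measurable]: "(\<lambda>y. y = None) \<in> star_measure N \<rightarrow>\<^sub>M count_space UNIV"
proof -
  have "{y \<in> space (star_measure N). y = None} \<in> sets (star_measure N)"
    by (auto simp: sets_star_measure vimage_def)
  then show ?thesis
    by (simp add: pred_def)
qed

text \<open>The domain of integration in \<open>implied\<close> depends on the argument, but only through its missingness
  pattern, of which there are finitely many. On the set where the pattern is \<open>m\<close>, the integral agrees
  with the integral \<open>J m\<close> over a fixed space, which is jointly measurable.\<close>
lemma implied_measurable:
  assumes I: "finite I" and sf: "\<And>j. j \<in> I \<Longrightarrow> sigma_finite_measure (\<mu> j)"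
    and \<phi>: "(\<lambda>(c, n). \<phi> c n) \<in> borel_measurable (C \<Otimes>\<^sub>M full_space \<mu> I)"
  shows "(\<lambda>(c, xs). implied \<mu> I (\<phi> c) xs) \<in> borel_measurable (C \<Otimes>\<^sub>M mat_space \<mu> I)"
proof -
  define J where "J m c xs = (\<integral>\<^sup>+ y. \<phi> c (\<lambda>j\<in>I. if m j then y j else observed_value (\<mu> j) (xs j), m)
      \<partial>PiM {j\<in>I. m j} \<mu>)" for m c and xs :: "nat \<Rightarrow> 'a option"
  \<comment> \<open>A pattern outside \<open>P\<close> observes a variable with empty sample space, so it never occurs.\<close>
  define P where "P = {m \<in> I \<rightarrow>\<^sub>E UNIV. \<forall>j\<in>I. \<not> m j \<longrightarrow> space (\<mu> j) \<noteq> {}}"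
  have P: "finite P" "\<And>m. m \<in> P \<Longrightarrow> m \<in> I \<rightarrow>\<^sub>E UNIV"
    by (auto simp: P_def intro: finite_subset[OF _ finite_patterns[OF I]])
  have J: "(\<lambda>(c, xs). J m c xs) \<in> borel_measurable (C \<Otimes>\<^sub>M mat_space \<mu> I)" if m: "m \<in> P" for m
  proof -
    interpret sigma_finite_measure "PiM {j\<in>I. m j} \<mu>"
      using I by (intro sigma_finite_PiM sf) auto
    have "(\<lambda>((c, xs), y). (\<lambda>j\<in>I. if m j then y j else observed_value (\<mu> j) (xs j)))
        \<in> (C \<Otimes>\<^sub>M mat_space \<mu> I) \<Otimes>\<^sub>M PiM {j\<in>I. m j} \<mu> \<rightarrow>\<^sub>M PiM I \<mu>"
      unfolding split_beta' mat_space_def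
    proof (rule measurable_restrict)
      fix j assume j: "j \<in> I"
      show "(\<lambda>x. if m j then snd x j else observed_value (\<mu> j) (snd (fst x) j))
        \<in> (C \<Otimes>\<^sub>M PiM I (\<lambda>j. star_measure (\<mu> j))) \<Otimes>\<^sub>M PiM {j\<in>I. m j} \<mu> \<rightarrow>\<^sub>M \<mu> j"
      proof (cases "m j")
        case False
        then have [measurable]: "observed_value (\<mu> j) \<in> star_measure (\<mu> j) \<rightarrow>\<^sub>M \<mu> j"
          using m j by (intro observed_value_measurable) (auto simp: P_def)
        show ?thesis
          using False j by simp
      qed (use j in simp)
    qed
    then have "(\<lambda>((c, xs), y). (c, \<lambda>j\<in>I. if m j then y j else observed_value (\<mu> j) (xs j), m))
        \<in> (C \<Otimes>\<^sub>M mat_space \<mu> I) \<Otimes>\<^sub>M PiM {j\<in>I. m j} \<mu> \<rightarrow>\<^sub>M C \<Otimes>\<^sub>M full_space \<mu> I"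
      using P(2)[OF m] unfolding full_space_def split_beta'
      by (intro measurable_Pair measurable_const) (auto simp: space_ind_space)
    from measurable_compose[OF this \<phi>]
    show ?thesis
      unfolding J_def case_prod_unfold by (intro borel_measurable_nn_integral) (simp add: case_prod_unfold)
  qed
  have meas: "(\<lambda>(c, xs). \<Sum>m\<in>P. if (\<forall>j\<in>I. (xs j = None) = m j) then J m c xs else 0)
      \<in> borel_measurable (C \<Otimes>\<^sub>M mat_space \<mu> I)"
    unfolding split_beta'
  proof (intro borel_measurable_sum measurable_If)
    fix m assume "m \<in> P"
    from J[OF this] show "(\<lambda>w. J m (fst w) (snd w)) \<in> borel_measurable (C \<Otimes>\<^sub>M mat_space \<mu> I)"
      by (simp add: split_beta')
    show "{w \<in> space (C \<Otimes>\<^sub>M mat_space \<mu> I). \<forall>j\<in>I. (snd w j = None) = m j} \<in> sets (C \<Otimes>\<^sub>M mat_space \<mu> I)"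
      unfolding mat_space_def using I by measurable
  qed simp
  have "implied \<mu> I (\<phi> c) xs = (\<Sum>m\<in>P. if (\<forall>j\<in>I. (xs j = None) = m j) then J m c xs else 0)"
    if xs: "xs \<in> space (mat_space \<mu> I)" for c xs
  proof -
    let ?m = "\<lambda>j\<in>I. xs j = None"
    have m: "?m \<in> P"
      using xs by (auto simp: P_def in_space_mat_space)
    have "(\<Sum>m\<in>P. if (\<forall>j\<in>I. (xs j = None) = m j) then J m c xs else 0) = (\<Sum>m\<in>P. if m = ?m then J m c xs else 0)"
    proof (intro sum.cong refl if_cong)
      fix m assume "m \<in> P"
      then have "m \<in> extensional I"
        using P(2) by (auto simp: PiE_def)
      then show "(\<forall>j\<in>I. (xs j = None) = m j) = (m = ?m)"
        by (auto simp: fun_eq_iff extensional_def)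
    qed
    also have "\<dots> = J ?m c xs"
      using m P(1) by simp
    also have "\<dots> = implied \<mu> I (\<phi> c) xs"
    proof -
      have "{j \<in> I. ?m j} = missing I xs"
        by auto
      moreover have "(\<lambda>j\<in>I. if ?m j then y j else observed_value (\<mu> j) (xs j), ?m) = fill I xs y" for y
        by (auto simp: fill_def fun_eq_iff observed_value_def split: option.split)
      ultimately show ?thesis
        unfolding J_def implied_fill by simp
    qed
    finally show ?thesis ..
  qed
  then show ?thesis
    by (intro measurable_cong[THEN iffD2, OF _ meas]) (auto simp: space_pair_measure)
qed

lemma implied_measurable':
  assumes I: "finite I" and sf: "\<And>j. j \<in> I \<Longrightarrow> sigma_finite_measure (\<mu> j)"
    and \<phi>: "\<phi> \<in> borel_measurable (full_space \<mu> I)"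
  shows "implied \<mu> I \<phi> \<in> borel_measurable (mat_space \<mu> I)"
proof -
  have "(\<lambda>(c, n). \<phi> n) \<in> borel_measurable (count_space {()} \<Otimes>\<^sub>M full_space \<mu> I)"
    using \<phi> by simp
  from implied_measurable[OF I sf this]
  have "(\<lambda>(c, xs). implied \<mu> I \<phi> xs) \<in> borel_measurable (count_space {()} \<Otimes>\<^sub>M mat_space \<mu> I)"
    by simp
  from measurable_compose[OF _ this, of "\<lambda>xs. ((), xs)" "mat_space \<mu> I"] show ?thesis
    by simp
qed

text \<open>On the set with pattern \<open>m\<close> the left side integrates the missing variables inside and the observed
  ones outside; by Fubini this is the integral over all variables. Summing over \<open>m\<close> is integration
  over the indicators.\<close>
lemma nn_integral_implied:
  assumes I: "finite I" and sf: "\<And>j. j \<in> I \<Longrightarrow> sigma_finite_measure (\<mu> j)"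
    and \<phi>: "\<phi> \<in> borel_measurable (full_space \<mu> I)"
  shows "(\<integral>\<^sup>+ xs. implied \<mu> I \<phi> xs \<partial>mat_space \<mu> I) = (\<integral>\<^sup>+ n. \<phi> n \<partial>full_space \<mu> I)"
proof -
  have "(\<integral>\<^sup>+ x. implied \<mu> I \<phi> (materialize I (x, m)) \<partial>PiM {j\<in>I. \<not> m j} \<mu>) = (\<integral>\<^sup>+ x. \<phi> (x, m) \<partial>PiM I \<mu>)"
    if m: "m \<in> I \<rightarrow>\<^sub>E UNIV" for m
  proof -
    have un: "{j\<in>I. \<not> m j} \<union> {j\<in>I. m j} = I"
      by auto
    have "(\<lambda>x. (x, m)) \<in> PiM I \<mu> \<rightarrow>\<^sub>M full_space \<mu> I"
      unfolding full_space_def using m by (simp add: space_ind_space)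
    from measurable_compose[OF this \<phi>]
    have "(\<lambda>x. \<phi> (x, m)) \<in> borel_measurable (PiM ({j\<in>I. \<not> m j} \<union> {j\<in>I. m j}) \<mu>)"
      by (simp only: un)
    from nn_integral_PiM_union[OF _ _ _ _ this] I sf show ?thesis
      unfolding implied_fill fill_materialize[OF m] un by fastforce
  qed
  then show ?thesis
    by (simp add: nn_integral_mat_space nn_integral_full_space implied_measurable' assms)
qed

text \<open>A factor that depends on the materialized values only is constant while the missing entries are
  integrated out.\<close>
lemma implied_materialize_mult:
  assumes xs: "xs \<in> space (mat_space \<mu> I)" and \<phi>: "\<phi> \<in> borel_measurable (full_space \<mu> I)"
  shows "implied \<mu> I (\<lambda>n. w (materialize I n) * \<phi> n) xs = w xs * implied \<mu> I \<phi> xs"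
  using xs measurable_compose[OF fill_measurable[OF xs] \<phi>] unfolding implied_fill
  by (simp add: materialize_fill in_space_mat_space nn_integral_cmult)

text \<open>The preimage of a null set \<open>N\<close> has measure \<open>\<integral> indicator N xs * implied \<mu> I (\<lambda>n. 1) xs\<close>. The
  second factor, the mass of the space of the missing entries, may be infinite, but the integrand
  still vanishes almost everywhere.\<close>
lemma nonsingular_materialize:
  assumes I: "finite I" and sf: "\<And>j. j \<in> I \<Longrightarrow> sigma_finite_measure (\<mu> j)"
  shows "nonsingular_map (full_space \<mu> I) (mat_space \<mu> I) (materialize I)"
proof (rule nonsingular_mapI[OF materialize_measurable])
  fix F :: "_ \<Rightarrow> ennreal"
  assume F: "F \<in> borel_measurable (mat_space \<mu> I)" and 0: "(\<integral>\<^sup>+ xs. F xs \<partial>mat_space \<mu> I) = 0"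
  have "(\<integral>\<^sup>+ n. F (materialize I n) * 1 \<partial>full_space \<mu> I) =
      (\<integral>\<^sup>+ xs. implied \<mu> I (\<lambda>n. F (materialize I n) * 1) xs \<partial>mat_space \<mu> I)"
    by (intro nn_integral_implied[symmetric] assms borel_measurable_times_ennreal
        measurable_compose[OF materialize_measurable F] borel_measurable_const)
  also have "\<dots> = (\<integral>\<^sup>+ xs. F xs * implied \<mu> I (\<lambda>n. 1) xs \<partial>mat_space \<mu> I)"
    by (intro nn_integral_cong implied_materialize_mult) simp_all
  also have "\<dots> = 0"
  proof -
    have "AE xs in mat_space \<mu> I. F xs = 0"
      using F 0 by (simp add: nn_integral_0_iff_AE)
    then have "(\<integral>\<^sup>+ xs. F xs * implied \<mu> I (\<lambda>n. 1) xs \<partial>mat_space \<mu> I) = (\<integral>\<^sup>+ xs. 0 \<partial>mat_space \<mu> I)"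
      by (intro nn_integral_cong_AE) auto
    then show ?thesis
      by simp
  qed
  finally show "(\<integral>\<^sup>+ n. F (materialize I n) \<partial>full_space \<mu> I) = 0"
    by simp
qed

text \<open>The converse of \<open>nonsingular_materialize\<close>: a null set of \<open>(X, M)\<close>-space meets almost every fibre of
  \<open>(X, M) \<mapsto> X*\<close> in a null set, because the integral of its implied density is zero.\<close>
lemma AE_fill:
  assumes I: "finite I" and sf: "\<And>j. j \<in> I \<Longrightarrow> sigma_finite_measure (\<mu> j)"
    and P: "AE w in C \<Otimes>\<^sub>M full_space \<mu> I. P w"
  shows "AE (c, xs) in C \<Otimes>\<^sub>M mat_space \<mu> I. AE y in PiM (missing I xs) \<mu>. P (c, fill I xs y)"
proof -
  interpret F: sigma_finite_measure "full_space \<mu> I"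
    by (rule sigma_finite_full_space[OF I sf])
  interpret M: sigma_finite_measure "mat_space \<mu> I"
    by (rule sigma_finite_mat_space[OF I sf])
  obtain A where A: "{w \<in> space (C \<Otimes>\<^sub>M full_space \<mu> I). \<not> P w} \<subseteq> A" "A \<in> null_sets (C \<Otimes>\<^sub>M full_space \<mu> I)"
    using P by (auto simp: eventually_ae_filter)
  let ?\<phi> = "\<lambda>c n. indicator A (c, n) :: ennreal"
  have \<phi>: "(\<lambda>(c, n). ?\<phi> c n) \<in> borel_measurable (C \<Otimes>\<^sub>M full_space \<mu> I)"
    using A(2) by auto
  have sec: "?\<phi> c \<in> borel_measurable (full_space \<mu> I)" if "c \<in> space C" for c
    using measurable_compose[OF measurable_Pair1'[OF that] \<phi>] by simp
  have meas: "(\<lambda>(c, xs). implied \<mu> I (?\<phi> c) xs) \<in> borel_measurable (C \<Otimes>\<^sub>M mat_space \<mu> I)"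
    by (rule implied_measurable[OF I sf \<phi>])
  have "(\<integral>\<^sup>+ (c, xs). implied \<mu> I (?\<phi> c) xs \<partial>(C \<Otimes>\<^sub>M mat_space \<mu> I)) =
      (\<integral>\<^sup>+ c. \<integral>\<^sup>+ xs. implied \<mu> I (?\<phi> c) xs \<partial>mat_space \<mu> I \<partial>C)"
    using M.nn_integral_fst[OF meas] by simp
  also have "\<dots> = (\<integral>\<^sup>+ c. \<integral>\<^sup>+ n. ?\<phi> c n \<partial>full_space \<mu> I \<partial>C)"
    by (intro nn_integral_cong nn_integral_implied[OF I sf] sec)
  also have "\<dots> = (\<integral>\<^sup>+ w. indicator A w \<partial>(C \<Otimes>\<^sub>M full_space \<mu> I))"
    using F.nn_integral_fst[OF \<phi>] by simp
  also have "\<dots> = 0"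
    using A(2) by (auto simp: null_sets_def)
  finally have "AE (c, xs) in C \<Otimes>\<^sub>M mat_space \<mu> I. implied \<mu> I (?\<phi> c) xs = 0"
    using meas by (simp add: nn_integral_0_iff_AE split_beta')
  then show ?thesis
    using AE_space
  proof eventually_elim
    case (elim w)
    obtain c xs where w: "w = (c, xs)"
      by (cases w)
    with elim have c: "c \<in> space C" and xs: "xs \<in> space (mat_space \<mu> I)"
      by (auto simp: space_pair_measure)
    have "AE y in PiM (missing I xs) \<mu>. ?\<phi> c (fill I xs y) = 0"
      using elim(1) measurable_compose[OF fill_measurable[OF xs] sec[OF c]]
      unfolding w implied_fill by (simp add: nn_integral_0_iff_AE)
    then have "AE y in PiM (missing I xs) \<mu>. P (c, fill I xs y)"
      using AE_space
    proof eventually_elim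
      case (elim y)
      then show ?case
        using A(1) c measurable_space[OF fill_measurable[OF xs] elim(2)]
        by (auto simp: space_pair_measure indicator_def split: if_splits)
    qed
    then show ?case
      by (simp add: w)
  qed
qed

lemma implied_cong_AE:
  assumes I: "finite I" and sf: "\<And>j. j \<in> I \<Longrightarrow> sigma_finite_measure (\<mu> j)"
    and "AE (c, n) in C \<Otimes>\<^sub>M full_space \<mu> I. \<phi> c n = \<psi> c n"
  shows "AE (c, xs) in C \<Otimes>\<^sub>M mat_space \<mu> I. implied \<mu> I (\<phi> c) xs = implied \<mu> I (\<psi> c) xs"
  using AE_fill[OF I sf assms(3)]
  by (rule AE_mp) (auto intro!: AE_I2 nn_integral_cong_AE simp: implied_fill)

text \<open>Fubini for the missing entries, split into those in \<open>I\<close> and those in \<open>J\<close>.\<close>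
lemma implied_union:
  assumes IJ: "I \<inter> J = {}" "finite I" "finite J"
    and sf: "\<And>j. j \<in> I \<union> J \<Longrightarrow> sigma_finite_measure (\<mu> j)"
    and \<phi>: "\<phi> \<in> borel_measurable (full_space \<mu> (I \<union> J))" and xs: "xs \<in> space (mat_space \<mu> (I \<union> J))"
  shows "implied \<mu> (I \<union> J) \<phi> xs =
    implied \<mu> I (\<lambda>(x, m). implied \<mu> J (\<lambda>(y, n). \<phi> (merge I J (x, y), merge I J (m, n))) (restrict xs J))
      (restrict xs I)"
proof -
  have miss: "missing (I \<union> J) xs = missing I xs \<union> missing J xs"
    "missing I (restrict xs I) = missing I xs" "missing J (restrict xs J) = missing J xs"
    by auto
  have fill: "fill (I \<union> J) xs (merge (missing I xs) (missing J xs) (x, y)) =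
      (merge I J (fst (fill I (restrict xs I) x), fst (fill J (restrict xs J) y)),
       merge I J (snd (fill I (restrict xs I) x), snd (fill J (restrict xs J) y)))" for x y
    using IJ(1) by (auto simp: fill_def merge_def fun_eq_iff split: option.split)
  have meas: "(\<lambda>y. \<phi> (fill (I \<union> J) xs y)) \<in> borel_measurable (PiM (missing I xs \<union> missing J xs) \<mu>)"
    using measurable_compose[OF fill_measurable[OF xs] \<phi>] by (simp only: miss)
  show ?thesis
    unfolding implied_fill miss split_beta'
    using IJ sf by (subst nn_integral_PiM_union[OF _ _ _ _ meas]) (auto simp: fill)
qed

section \<open>Cutting mixed spaces along a block\<close>

text \<open>A mixed space whose starred part begins with block \<open>B\<close> is the product of the space without
  that block and the space of \<open>X*\<^sub>B\<close>; a mixed space whose unstarred part ends with block \<open>B\<close> is the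
  product of the space without that block and the space of \<open>(X\<^sub>B, M\<^sub>B)\<close>. The following maps are these
  identifications and their inverses; \<open>Z\<close> is the set of variables after the block, \<open>I\<close> of those
  before it, and \<open>S\<close> the set of indicators besides those of the block.\<close>
definition join_star :: "nat set \<Rightarrow> nat set \<Rightarrow> 'a mixed \<times> (nat \<Rightarrow> 'a option) \<Rightarrow> 'a mixed" where
  "join_star B Z = (\<lambda>((x, m, zs), ys). (x, m, merge B Z (ys, zs)))"

definition cut_star :: "nat set \<Rightarrow> nat set \<Rightarrow> 'a mixed \<Rightarrow> 'a mixed \<times> (nat \<Rightarrow> 'a option)" where
  "cut_star B Z = (\<lambda>(x, m, xs). ((x, m, restrict xs Z), restrict xs B))"

definition join_full ::
  "nat set \<Rightarrow> nat set \<Rightarrow> nat set \<Rightarrow> 'a mixed \<times> (nat \<Rightarrow> 'a) \<times> (nat \<Rightarrow> bool) \<Rightarrow> 'a mixed" where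
  "join_full I S B = (\<lambda>((x, m, zs), y, n). (merge I B (x, y), merge S B (m, n), zs))"

definition cut_full ::
  "nat set \<Rightarrow> nat set \<Rightarrow> nat set \<Rightarrow> 'a mixed \<Rightarrow> 'a mixed \<times> (nat \<Rightarrow> 'a) \<times> (nat \<Rightarrow> bool)" where
  "cut_full I S B = (\<lambda>(x, m, zs). ((restrict x I, restrict m S, zs), restrict x B, restrict m B))"

lemma space_mixed_space:
  "space (mixed_space \<mu> p a S b) = space (PiM {1..a} \<mu>) \<times> (S \<rightarrow>\<^sub>E UNIV) \<times> space (mat_space \<mu> {b<..p})"
  by (simp add: mixed_space_def space_pair_measure space_ind_space)

lemma space_full_space: "space (full_space \<mu> I) = space (PiM I \<mu>) \<times> (I \<rightarrow>\<^sub>E UNIV)"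
  by (simp add: full_space_def space_pair_measure space_ind_space)

lemma merge_bool_measurable:
  assumes "finite S" "finite B"
  shows "merge S B \<in> ind_space S \<Otimes>\<^sub>M ind_space B \<rightarrow>\<^sub>M ind_space (S \<union> B)"
  using measurable_merge[of S B "\<lambda>_. count_space UNIV"] assms by (simp add: ind_space_eq_PiM)

lemma restrict_bool_measurable:
  "R \<subseteq> S \<Longrightarrow> (\<lambda>m. restrict m R) \<in> ind_space S \<rightarrow>\<^sub>M ind_space R"
  by (simp add: measurable_ind_space space_ind_space)

lemma merge_mat_measurable: "merge B Z \<in> mat_space \<mu> B \<Otimes>\<^sub>M mat_space \<mu> Z \<rightarrow>\<^sub>M mat_space \<mu> (B \<union> Z)"
  unfolding mat_space_def by (rule measurable_merge)

lemma restrict_mat_measurable: "J \<subseteq> I \<Longrightarrow> (\<lambda>xs. restrict xs J) \<in> mat_space \<mu> I \<rightarrow>\<^sub>M mat_space \<mu> J"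
  unfolding mat_space_def by (rule measurable_restrict_subset)

text \<open>Counting measure has no nonempty null sets, so any change of the indicators is nonsingular.\<close>
lemma nonsingular_indicators:
  assumes "finite S" "finite T" "a \<le> p" and sf: "\<And>j. j \<in> {1..p} \<Longrightarrow> sigma_finite_measure (\<mu> j)"
    and \<phi>: "\<And>m. m \<in> S \<rightarrow>\<^sub>E UNIV \<Longrightarrow> \<phi> m \<in> T \<rightarrow>\<^sub>E UNIV"
  shows "nonsingular_map (mixed_space \<mu> p a S b) (mixed_space \<mu> p a T b) (\<lambda>(x, m, zs). (x, \<phi> m, zs))"
proof -
  have sfs: "sigma_finite_measure (PiM {1..a} \<mu>)" "sigma_finite_measure (ind_space S)"
    "sigma_finite_measure (ind_space T)" "sigma_finite_measure (mat_space \<mu> {b<..p})"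
    using assms by (auto intro!: sigma_finite_PiM sigma_finite_ind_space sigma_finite_mat_space)
  have "nonsingular_map (ind_space S) (ind_space T) \<phi>"
    unfolding ind_space_def by (intro nonsingular_map_count_space \<phi>)
  then have "nonsingular_map (ind_space S \<Otimes>\<^sub>M mat_space \<mu> {b<..p}) (ind_space T \<Otimes>\<^sub>M mat_space \<mu> {b<..p})
      (\<lambda>(m, zs). (\<phi> m, zs))"
    by (intro nonsingular_map_pair[OF _ nonsingular_map_id] sfs)
  from nonsingular_map_pair[OF nonsingular_map_id this sigma_finite_pair_measure sfs(1) sigma_finite_pair_measure] sfs
  show ?thesis
    unfolding mixed_space_def by (simp add: split_beta')
qed

lemma nn_integral_mixed_space:
  assumes "finite S" "a \<le> p" and sf: "\<And>j. j \<in> {1..p} \<Longrightarrow> sigma_finite_measure (\<mu> j)"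
    and F: "F \<in> borel_measurable (mixed_space \<mu> p a S b)"
  shows "(\<integral>\<^sup>+ s. F s \<partial>mixed_space \<mu> p a S b) =
    (\<integral>\<^sup>+ x. \<integral>\<^sup>+ m. \<integral>\<^sup>+ zs. F (x, m, zs) \<partial>mat_space \<mu> {b<..p} \<partial>ind_space S \<partial>PiM {1..a} \<mu>)"
proof -
  interpret Z: sigma_finite_measure "mat_space \<mu> {b<..p}"
    using sf by (intro sigma_finite_mat_space) auto
  interpret IZ: sigma_finite_measure "ind_space S \<Otimes>\<^sub>M mat_space \<mu> {b<..p}"
    using assms(1) by (intro sigma_finite_pair_measure sigma_finite_ind_space Z.sigma_finite_measure_axioms)
  have [measurable]: "F \<in> borel_measurable (PiM {1..a} \<mu> \<Otimes>\<^sub>M (ind_space S \<Otimes>\<^sub>M mat_space \<mu> {b<..p}))"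
    using F by (simp add: mixed_space_def)
  have "(\<integral>\<^sup>+ s. F s \<partial>mixed_space \<mu> p a S b) =
      (\<integral>\<^sup>+ x. \<integral>\<^sup>+ w. F (x, w) \<partial>(ind_space S \<Otimes>\<^sub>M mat_space \<mu> {b<..p}) \<partial>PiM {1..a} \<mu>)"
    unfolding mixed_space_def by (rule IZ.nn_integral_fst[symmetric]) measurable
  also have "\<dots> = (\<integral>\<^sup>+ x. \<integral>\<^sup>+ m. \<integral>\<^sup>+ zs. F (x, m, zs) \<partial>mat_space \<mu> {b<..p} \<partial>ind_space S \<partial>PiM {1..a} \<mu>)"
    by (intro nn_integral_cong Z.nn_integral_fst[symmetric]) measurable
  finally show ?thesis .
qed

lemma nn_integral_mixed_pair:
  assumes "finite S" "a \<le> p" and sf: "\<And>j. j \<in> {1..p} \<Longrightarrow> sigma_finite_measure (\<mu> j)"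
    and N: "sigma_finite_measure N" and F: "F \<in> borel_measurable (mixed_space \<mu> p a S b \<Otimes>\<^sub>M N)"
  shows "(\<integral>\<^sup>+ w. F w \<partial>(mixed_space \<mu> p a S b \<Otimes>\<^sub>M N)) =
    (\<integral>\<^sup>+ x. \<integral>\<^sup>+ m. \<integral>\<^sup>+ zs. \<integral>\<^sup>+ n. F ((x, m, zs), n) \<partial>N \<partial>mat_space \<mu> {b<..p} \<partial>ind_space S \<partial>PiM {1..a} \<mu>)"
proof -
  interpret N: sigma_finite_measure N by fact
  have "(\<integral>\<^sup>+ w. F w \<partial>(mixed_space \<mu> p a S b \<Otimes>\<^sub>M N)) = (\<integral>\<^sup>+ s. \<integral>\<^sup>+ n. F (s, n) \<partial>N \<partial>mixed_space \<mu> p a S b)"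
    using F by (rule N.nn_integral_fst[symmetric])
  also have "\<dots> = (\<integral>\<^sup>+ x. \<integral>\<^sup>+ m. \<integral>\<^sup>+ zs. \<integral>\<^sup>+ n. F ((x, m, zs), n) \<partial>N \<partial>mat_space \<mu> {b<..p} \<partial>ind_space S \<partial>PiM {1..a} \<mu>)"
    by (intro nn_integral_mixed_space assms(1-3) N.borel_measurable_nn_integral_fst F)
  finally show ?thesis .
qed

lemma join_star_preserving:
  assumes S: "finite S" and ab: "a \<le> b" "b \<le> p"
    and sf: "\<And>j. j \<in> {1..p} \<Longrightarrow> sigma_finite_measure (\<mu> j)"
  shows "measure_preserving (mixed_space \<mu> p a S b \<Otimes>\<^sub>M mat_space \<mu> {a<..b}) (mixed_space \<mu> p a S a)
    (join_star {a<..b} {b<..p})"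
proof (rule measure_preservingI)
  let ?B = "{a<..b}" and ?Z = "{b<..p}"
  have un: "{a<..p} = ?B \<union> ?Z"
    using ab by auto
  note [measurable] = merge_mat_measurable[of ?B ?Z, folded un]
  show meas[measurable]: "join_star ?B ?Z \<in> mixed_space \<mu> p a S b \<Otimes>\<^sub>M mat_space \<mu> ?B \<rightarrow>\<^sub>M mixed_space \<mu> p a S a"
    unfolding mixed_space_def join_star_def case_prod_unfold by measurable
  fix F :: "'a mixed \<Rightarrow> ennreal"
  assume F[measurable]: "F \<in> borel_measurable (mixed_space \<mu> p a S a)"
  have sfB: "sigma_finite_measure (mat_space \<mu> ?B)" and sfZ: "sigma_finite_measure (mat_space \<mu> ?Z)"
    using sf ab by (auto intro!: sigma_finite_mat_space)
  interpret BZ: pair_sigma_finite "mat_space \<mu> ?B" "mat_space \<mu> ?Z"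
    using sfB sfZ by (simp add: pair_sigma_finite_def)
  have "(\<integral>\<^sup>+ v. F (join_star ?B ?Z v) \<partial>(mixed_space \<mu> p a S b \<Otimes>\<^sub>M mat_space \<mu> ?B)) =
     (\<integral>\<^sup>+ x. \<integral>\<^sup>+ m. \<integral>\<^sup>+ zs. \<integral>\<^sup>+ ys. F (x, m, merge ?B ?Z (ys, zs))
        \<partial>mat_space \<mu> ?B \<partial>mat_space \<mu> ?Z \<partial>ind_space S \<partial>PiM {1..a} \<mu>)"
    using ab S sf sfB measurable_compose[OF meas F]
    by (subst nn_integral_mixed_pair) (auto simp: join_star_def)
  also have "\<dots> = (\<integral>\<^sup>+ x. \<integral>\<^sup>+ m. \<integral>\<^sup>+ xs. F (x, m, xs) \<partial>mat_space \<mu> {a<..p} \<partial>ind_space S \<partial>PiM {1..a} \<mu>)"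
  proof (intro nn_integral_cong)
    fix x and m :: "nat \<Rightarrow> bool"
    assume x: "x \<in> space (PiM {1..a} \<mu>)" and m: "m \<in> space (ind_space S)"
    have xm[measurable]: "(\<lambda>xs. F (x, m, xs)) \<in> borel_measurable (mat_space \<mu> {a<..p})"
      using F x m unfolding mixed_space_def by measurable
    have "(\<integral>\<^sup>+ zs. \<integral>\<^sup>+ ys. F (x, m, merge ?B ?Z (ys, zs)) \<partial>mat_space \<mu> ?B \<partial>mat_space \<mu> ?Z) =
      (\<integral>\<^sup>+ ys. \<integral>\<^sup>+ zs. F (x, m, merge ?B ?Z (ys, zs)) \<partial>mat_space \<mu> ?Z \<partial>mat_space \<mu> ?B)"
      by (rule BZ.Fubini') measurable
    also have "\<dots> = (\<integral>\<^sup>+ xs. F (x, m, xs) \<partial>mat_space \<mu> {a<..p})"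
      using sf ab xm unfolding un mat_space_def
      by (intro nn_integral_PiM_union[symmetric] sigma_finite_star_measure) auto
    finally show "(\<integral>\<^sup>+ zs. \<integral>\<^sup>+ ys. F (x, m, merge ?B ?Z (ys, zs)) \<partial>mat_space \<mu> ?B \<partial>mat_space \<mu> ?Z) =
      (\<integral>\<^sup>+ xs. F (x, m, xs) \<partial>mat_space \<mu> {a<..p})" .
  qed
  also have "\<dots> = (\<integral>\<^sup>+ s. F s \<partial>mixed_space \<mu> p a S a)"
    using ab by (intro nn_integral_mixed_space[symmetric] S sf F) auto
  finally show "(\<integral>\<^sup>+ v. F (join_star ?B ?Z v) \<partial>(mixed_space \<mu> p a S b \<Otimes>\<^sub>M mat_space \<mu> ?B)) =
    (\<integral>\<^sup>+ s. F s \<partial>mixed_space \<mu> p a S a)" .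
qed

lemma cut_star_measurable:
  assumes "a \<le> b" "b \<le> p"
  shows "cut_star {a<..b} {b<..p} \<in> mixed_space \<mu> p a S a \<rightarrow>\<^sub>M mixed_space \<mu> p a S b \<Otimes>\<^sub>M mat_space \<mu> {a<..b}"
proof -
  have [measurable]: "(\<lambda>xs. restrict xs {b<..p}) \<in> mat_space \<mu> {a<..p} \<rightarrow>\<^sub>M mat_space \<mu> {b<..p}"
    "(\<lambda>xs. restrict xs {a<..b}) \<in> mat_space \<mu> {a<..p} \<rightarrow>\<^sub>M mat_space \<mu> {a<..b}"
    using assms by (auto intro!: restrict_mat_measurable)
  show ?thesis
    unfolding mixed_space_def cut_star_def by measurable
qed

lemma cut_join_star:
  assumes "v \<in> space (mixed_space \<mu> p a S b \<Otimes>\<^sub>M mat_space \<mu> {a<..b})"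
  shows "cut_star {a<..b} {b<..p} (join_star {a<..b} {b<..p} v) = v"
  using assms
  by (auto simp: cut_star_def join_star_def space_pair_measure space_mixed_space in_space_mat_space
      fun_eq_iff merge_def extensional_def)

lemma join_cut_star:
  assumes "a \<le> b" "b \<le> p" and "s \<in> space (mixed_space \<mu> p a S a)"
  shows "join_star {a<..b} {b<..p} (cut_star {a<..b} {b<..p} s) = s"
  using assms
  by (auto simp: cut_star_def join_star_def space_mixed_space in_space_mat_space
      fun_eq_iff merge_def extensional_def)

lemma AE_join_star_iff:
  assumes "finite S" "a \<le> b" "b \<le> p" and sf: "\<And>j. j \<in> {1..p} \<Longrightarrow> sigma_finite_measure (\<mu> j)"
  shows "(AE s in mixed_space \<mu> p a S a. P s) \<longleftrightarrow>
    (AE v in mixed_space \<mu> p a S b \<Otimes>\<^sub>M mat_space \<mu> {a<..b}. P (join_star {a<..b} {b<..p} v))"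
  by (rule AE_measure_preserving_iff[OF join_star_preserving cut_star_measurable cut_join_star join_cut_star])
    (use assms in auto)

text \<open>Fubini: the integrals over \<open>X\<^sub>B\<close> and \<open>M\<^sub>B\<close> are moved outward until they are next to
  those over the earlier variables and indicators, and are then merged with them.\<close>
lemma join_full_preserving:
  assumes S: "finite S" and ab: "a \<le> b" "b \<le> p" and disj: "S \<inter> {a<..b} = {}"
    and sf: "\<And>j. j \<in> {1..p} \<Longrightarrow> sigma_finite_measure (\<mu> j)"
  shows "measure_preserving (mixed_space \<mu> p a S b \<Otimes>\<^sub>M full_space \<mu> {a<..b})
    (mixed_space \<mu> p b (S \<union> {a<..b}) b) (join_full {1..a} S {a<..b})"
proof (rule measure_preservingI)
  let ?I = "{1..a}" and ?B = "{a<..b}" and ?Z = "{b<..p}"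
  have un: "{1..b} = ?I \<union> ?B"
    using ab by auto
  note [measurable] = measurable_merge[of ?I ?B, folded un] merge_bool_measurable[OF S, of ?B, simplified]
  show meas[measurable]: "join_full ?I S ?B \<in> mixed_space \<mu> p a S b \<Otimes>\<^sub>M full_space \<mu> ?B \<rightarrow>\<^sub>M
      mixed_space \<mu> p b (S \<union> ?B) b"
    unfolding mixed_space_def join_full_def full_space_def case_prod_unfold by measurable
  fix F :: "'a mixed \<Rightarrow> ennreal"
  assume F: "F \<in> borel_measurable (mixed_space \<mu> p b (S \<union> ?B) b)"
  then have [measurable]: "F \<in> borel_measurable (PiM {1..b} \<mu> \<Otimes>\<^sub>M (ind_space (S \<union> ?B) \<Otimes>\<^sub>M mat_space \<mu> ?Z))"
    by (simp add: mixed_space_def)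
  have sfB: "sigma_finite_measure (full_space \<mu> ?B)" and sfZ: "sigma_finite_measure (mat_space \<mu> ?Z)"
    and sfX: "sigma_finite_measure (PiM ?B \<mu>)" and sfS: "sigma_finite_measure (ind_space S)"
    and sfN: "sigma_finite_measure (ind_space ?B)"
    using sf ab S by (auto intro!: sigma_finite_mat_space sigma_finite_full_space sigma_finite_PiM sigma_finite_ind_space)
  interpret N: sigma_finite_measure "ind_space ?B" by (rule sfN)
  interpret Z: sigma_finite_measure "mat_space \<mu> ?Z" by (rule sfZ)
  interpret XZ: pair_sigma_finite "PiM ?B \<mu>" "mat_space \<mu> ?Z"
    using sfX sfZ by (simp add: pair_sigma_finite_def)
  interpret NZ: pair_sigma_finite "ind_space ?B" "mat_space \<mu> ?Z"
    using sfN sfZ by (simp add: pair_sigma_finite_def)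
  interpret XS: pair_sigma_finite "PiM ?B \<mu>" "ind_space S"
    using sfX sfS by (simp add: pair_sigma_finite_def)
  let ?F = "\<lambda>x y m n zs. F (merge ?I ?B (x, y), merge S ?B (m, n), zs)"
  have "(\<integral>\<^sup>+ v. F (join_full ?I S ?B v) \<partial>(mixed_space \<mu> p a S b \<Otimes>\<^sub>M full_space \<mu> ?B)) =
     (\<integral>\<^sup>+ x. \<integral>\<^sup>+ m. \<integral>\<^sup>+ zs. \<integral>\<^sup>+ w. ?F x (fst w) m (snd w) zs
        \<partial>full_space \<mu> ?B \<partial>mat_space \<mu> ?Z \<partial>ind_space S \<partial>PiM ?I \<mu>)"
    using ab S sf sfB measurable_compose[OF meas F]
    by (subst nn_integral_mixed_pair) (auto simp: join_full_def split_beta')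
  also have "\<dots> = (\<integral>\<^sup>+ x. \<integral>\<^sup>+ m. \<integral>\<^sup>+ zs. \<integral>\<^sup>+ y. \<integral>\<^sup>+ n. ?F x y m n zs
        \<partial>ind_space ?B \<partial>PiM ?B \<mu> \<partial>mat_space \<mu> ?Z \<partial>ind_space S \<partial>PiM ?I \<mu>)"
  proof (intro nn_integral_cong)
    fix x m zs
    assume [measurable]: "x \<in> space (PiM ?I \<mu>)" "m \<in> space (ind_space S)" "zs \<in> space (mat_space \<mu> ?Z)"
    have "(\<lambda>w. ?F x (fst w) m (snd w) zs) \<in> borel_measurable (PiM ?B \<mu> \<Otimes>\<^sub>M ind_space ?B)"
      by measurable
    from N.nn_integral_fst[OF this]
    show "(\<integral>\<^sup>+ w. ?F x (fst w) m (snd w) zs \<partial>full_space \<mu> ?B) =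
        (\<integral>\<^sup>+ y. \<integral>\<^sup>+ n. ?F x y m n zs \<partial>ind_space ?B \<partial>PiM ?B \<mu>)"
      by (simp add: full_space_def)
  qed
  also have "\<dots> = (\<integral>\<^sup>+ x. \<integral>\<^sup>+ m. \<integral>\<^sup>+ y. \<integral>\<^sup>+ zs. \<integral>\<^sup>+ n. ?F x y m n zs
        \<partial>ind_space ?B \<partial>mat_space \<mu> ?Z \<partial>PiM ?B \<mu> \<partial>ind_space S \<partial>PiM ?I \<mu>)"
    by (intro nn_integral_cong XZ.Fubini') measurable
  also have "\<dots> = (\<integral>\<^sup>+ x. \<integral>\<^sup>+ m. \<integral>\<^sup>+ y. \<integral>\<^sup>+ n. \<integral>\<^sup>+ zs. ?F x y m n zs
        \<partial>mat_space \<mu> ?Z \<partial>ind_space ?B \<partial>PiM ?B \<mu> \<partial>ind_space S \<partial>PiM ?I \<mu>)"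
    by (intro nn_integral_cong NZ.Fubini') measurable
  also have "\<dots> = (\<integral>\<^sup>+ x. \<integral>\<^sup>+ y. \<integral>\<^sup>+ m. \<integral>\<^sup>+ n. \<integral>\<^sup>+ zs. ?F x y m n zs
        \<partial>mat_space \<mu> ?Z \<partial>ind_space ?B \<partial>ind_space S \<partial>PiM ?B \<mu> \<partial>PiM ?I \<mu>)"
    by (intro nn_integral_cong XS.Fubini') measurable
  also have "\<dots> = (\<integral>\<^sup>+ x. \<integral>\<^sup>+ y. \<integral>\<^sup>+ m. \<integral>\<^sup>+ zs. F (merge ?I ?B (x, y), m, zs)
        \<partial>mat_space \<mu> ?Z \<partial>ind_space (S \<union> ?B) \<partial>PiM ?B \<mu> \<partial>PiM ?I \<mu>)"
  proof (intro nn_integral_cong)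
    fix x y assume [measurable]: "x \<in> space (PiM ?I \<mu>)" "y \<in> space (PiM ?B \<mu>)"
    have "(\<lambda>m. \<integral>\<^sup>+ zs. F (merge ?I ?B (x, y), m, zs) \<partial>mat_space \<mu> ?Z) \<in> borel_measurable (ind_space (S \<union> ?B))"
      by measurable
    then show "(\<integral>\<^sup>+ m. \<integral>\<^sup>+ n. \<integral>\<^sup>+ zs. ?F x y m n zs \<partial>mat_space \<mu> ?Z \<partial>ind_space ?B \<partial>ind_space S) =
      (\<integral>\<^sup>+ m. \<integral>\<^sup>+ zs. F (merge ?I ?B (x, y), m, zs) \<partial>mat_space \<mu> ?Z \<partial>ind_space (S \<union> ?B))"
      using disj S by (simp add: ind_space_eq_PiM nn_integral_PiM_union sigma_finite_measure_count_space)
  qed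
  also have "\<dots> = (\<integral>\<^sup>+ x. \<integral>\<^sup>+ m. \<integral>\<^sup>+ zs. F (x, m, zs)
        \<partial>mat_space \<mu> ?Z \<partial>ind_space (S \<union> ?B) \<partial>PiM {1..b} \<mu>)"
  proof -
    interpret SB: sigma_finite_measure "ind_space (S \<union> ?B)"
      using S by (intro sigma_finite_ind_space) simp
    have "(\<lambda>x. \<integral>\<^sup>+ m. \<integral>\<^sup>+ zs. F (x, m, zs) \<partial>mat_space \<mu> ?Z \<partial>ind_space (S \<union> ?B)) \<in> borel_measurable (PiM {1..b} \<mu>)"
      by measurable
    then show ?thesis
      using sf ab unfolding un by (intro nn_integral_PiM_union[symmetric]) auto
  qed
  also have "\<dots> = (\<integral>\<^sup>+ s. F s \<partial>mixed_space \<mu> p b (S \<union> ?B) b)"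
    using ab S by (intro nn_integral_mixed_space[symmetric] sf F) auto
  finally show "(\<integral>\<^sup>+ v. F (join_full ?I S ?B v) \<partial>(mixed_space \<mu> p a S b \<Otimes>\<^sub>M full_space \<mu> ?B)) =
    (\<integral>\<^sup>+ s. F s \<partial>mixed_space \<mu> p b (S \<union> ?B) b)" .
qed

lemma cut_full_measurable:
  assumes "a \<le> b" "b \<le> p"
  shows "cut_full {1..a} S {a<..b} \<in> mixed_space \<mu> p b (S \<union> {a<..b}) b \<rightarrow>\<^sub>M
    mixed_space \<mu> p a S b \<Otimes>\<^sub>M full_space \<mu> {a<..b}"
proof -
  have [measurable]: "(\<lambda>x. restrict x {1..a}) \<in> PiM {1..b} \<mu> \<rightarrow>\<^sub>M PiM {1..a} \<mu>"
    "(\<lambda>x. restrict x {a<..b}) \<in> PiM {1..b} \<mu> \<rightarrow>\<^sub>M PiM {a<..b} \<mu>"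
    "(\<lambda>m. restrict m S) \<in> ind_space (S \<union> {a<..b}) \<rightarrow>\<^sub>M ind_space S"
    "(\<lambda>m. restrict m {a<..b}) \<in> ind_space (S \<union> {a<..b}) \<rightarrow>\<^sub>M ind_space {a<..b}"
    using assms by (auto intro!: measurable_restrict_subset restrict_bool_measurable)
  show ?thesis
    unfolding mixed_space_def full_space_def cut_full_def by measurable
qed

lemma cut_join_full:
  assumes "S \<inter> {a<..b} = {}" and "v \<in> space (mixed_space \<mu> p a S b \<Otimes>\<^sub>M full_space \<mu> {a<..b})"
  shows "cut_full {1..a} S {a<..b} (join_full {1..a} S {a<..b} v) = v"
proof -
  have "\<not> x \<le> b" if "x \<in> S" "a < x" for x
    using assms(1) that by auto
  then show ?thesis
    using assms(2)
    by (auto simp: cut_full_def join_full_def space_pair_measure space_mixed_space space_full_space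
        space_PiM PiE_def fun_eq_iff merge_def extensional_def)
qed

lemma join_cut_full:
  assumes "a \<le> b" "b \<le> p" and "s \<in> space (mixed_space \<mu> p b (S \<union> {a<..b}) b)"
  shows "join_full {1..a} S {a<..b} (cut_full {1..a} S {a<..b} s) = s"
  using assms
  by (auto simp: cut_full_def join_full_def space_mixed_space space_PiM PiE_def
      fun_eq_iff merge_def extensional_def)

lemma AE_join_full_iff:
  assumes "finite S" "a \<le> b" "b \<le> p" "S \<inter> {a<..b} = {}"
    and sf: "\<And>j. j \<in> {1..p} \<Longrightarrow> sigma_finite_measure (\<mu> j)"
  shows "(AE s in mixed_space \<mu> p b (S \<union> {a<..b}) b. P s) \<longleftrightarrow>
    (AE v in mixed_space \<mu> p a S b \<Otimes>\<^sub>M full_space \<mu> {a<..b}. P (join_full {1..a} S {a<..b} v))"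
  by (rule AE_measure_preserving_iff[OF join_full_preserving cut_full_measurable cut_join_full join_cut_full])
    (use assms in auto)

section \<open>Summing out indicators\<close>

lemma keep_indicators_eq_sum:
  assumes "finite S"
  shows "keep_indicators S R F (x, m, zs) = (\<Sum>m'\<in>S \<rightarrow>\<^sub>E UNIV. if restrict m' R = m then F (x, m', zs) else 0)"
  using finite_patterns[OF assms]
  by (simp add: keep_indicators_def sum.If_cases Int_def conj_commute)

lemma keep_indicators_measurable:
  assumes "finite S" and F: "F \<in> borel_measurable (mixed_space \<mu> p a S b)"
  shows "keep_indicators S R F \<in> borel_measurable (mixed_space \<mu> p a R b)"
proof -
  have "(\<lambda>(x, m, zs). \<Sum>m'\<in>S \<rightarrow>\<^sub>E UNIV. if restrict m' R = m then F (x, m', zs) else 0)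
      \<in> borel_measurable (mixed_space \<mu> p a R b)"
    unfolding split_beta'
  proof (intro borel_measurable_sum measurable_If)
    fix m' :: "nat \<Rightarrow> bool" assume m': "m' \<in> S \<rightarrow>\<^sub>E UNIV"
    have "(\<lambda>s. (fst s, m', snd (snd s))) \<in> mixed_space \<mu> p a R b \<rightarrow>\<^sub>M mixed_space \<mu> p a S b"
      using m' unfolding mixed_space_def by (simp add: space_ind_space)
    then show "(\<lambda>s. F (fst s, m', snd (snd s))) \<in> borel_measurable (mixed_space \<mu> p a R b)"
      by (rule measurable_compose[OF _ F])
    have "(\<lambda>m. restrict m' R = m) \<in> ind_space R \<rightarrow>\<^sub>M count_space UNIV"
      by (simp add: measurable_ind_space)
    then show "{s \<in> space (mixed_space \<mu> p a R b). restrict m' R = fst (snd s)} \<in> sets (mixed_space \<mu> p a R b)"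
      unfolding mixed_space_def by measurable
  qed simp
  then show ?thesis
    by (rule measurable_cong[THEN iffD2, rotated]) (auto simp: keep_indicators_eq_sum assms(1))
qed

text \<open>For each pattern \<open>m'\<close>, prescribing the summed-out indicators by \<open>m'\<close> is a nonsingular map from
  the space with indicators in \<open>R\<close> to the one with indicators in \<open>S\<close>. The finitely many pull-backs
  of the given equality cover all the summands.\<close>
lemma keep_indicators_cong_AE:
  assumes "finite S" "R \<subseteq> S" "a \<le> p" and sf: "\<And>j. j \<in> {1..p} \<Longrightarrow> sigma_finite_measure (\<mu> j)"
    and AE: "AE s in mixed_space \<mu> p a S b. F s = G s"
  shows "AE s in mixed_space \<mu> p a R b. keep_indicators S R F s = keep_indicators S R G s"
proof -
  let ?\<phi> = "\<lambda>m' m. \<lambda>j\<in>S. if j \<in> R then m j else m' j :: bool"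
  have "AE s in mixed_space \<mu> p a R b. \<forall>m'\<in>S \<rightarrow>\<^sub>E UNIV. (\<lambda>(x, m, zs). F (x, ?\<phi> m' m, zs) = G (x, ?\<phi> m' m, zs)) s"
  proof (rule AE_finite_allI[OF finite_patterns[OF assms(1)]])
    fix m' :: "nat \<Rightarrow> bool"
    have "nonsingular_map (mixed_space \<mu> p a R b) (mixed_space \<mu> p a S b) (\<lambda>(x, m, zs). (x, ?\<phi> m' m, zs))"
      using assms(1-3) finite_subset[OF assms(2,1)] by (intro nonsingular_indicators sf) auto
    from AE_nonsingular_map[OF this AE]
    show "AE s in mixed_space \<mu> p a R b. (\<lambda>(x, m, zs). F (x, ?\<phi> m' m, zs) = G (x, ?\<phi> m' m, zs)) s"
      by (simp add: split_beta')
  qed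
  then show ?thesis
  proof eventually_elim
    case (elim s)
    obtain x m zs where s: "s = (x, m, zs)"
      by (metis prod.exhaust)
    have "F (x, m', zs) = G (x, m', zs)" if "m' \<in> S \<rightarrow>\<^sub>E UNIV" "restrict m' R = m" for m'
    proof -
      have "?\<phi> m' m = m'"
        using that(1) assms(2) unfolding that(2)[symmetric]
        by (auto simp: fun_eq_iff PiE_def extensional_def)
      then show ?thesis
        using elim that(1) unfolding s by fastforce
    qed
    then show ?case
      unfolding s keep_indicators_def by (auto intro!: sum.cong)
  qed
qed

lemma keep_indicators_trans:
  assumes "finite T" "S \<subseteq> T" "R \<subseteq> S"
  shows "keep_indicators S R (keep_indicators T S F) = keep_indicators T R F"
proof (clarsimp simp: fun_eq_iff)
  fix x and m :: "nat \<Rightarrow> bool" and zs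
  let ?A = "{m'. m' \<in> T \<rightarrow>\<^sub>E UNIV \<and> restrict m' R = m}"
  let ?B = "{m'. m' \<in> S \<rightarrow>\<^sub>E UNIV \<and> restrict m' R = m}"
  have "finite ?A"
    by (rule finite_subset[OF _ finite_patterns[OF assms(1)]]) auto
  moreover have "finite ?B"
    by (rule finite_subset[OF _ finite_patterns[OF finite_subset[OF assms(2,1)]]]) auto
  ultimately have fin: "finite ?A" "finite ?B" .
  have sub: "(\<lambda>m'. restrict m' S) ` ?A \<subseteq> ?B"
    using assms(3) by (auto simp: restrict_restrict Int_absorb1)
  have "(\<Sum>m'\<in>?B. \<Sum>m''\<in>{m''\<in>?A. restrict m'' S = m'}. F (x, m'', zs)) = (\<Sum>m''\<in>?A. F (x, m'', zs))"
    by (rule sum.group[OF fin sub])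
  moreover have "{m''\<in>?A. restrict m'' S = m'} = {m''. m'' \<in> T \<rightarrow>\<^sub>E UNIV \<and> restrict m'' S = m'}" if "m' \<in> ?B" for m'
    using that assms(3) by (auto simp: restrict_restrict Int_absorb1)
  ultimately show "keep_indicators S R (keep_indicators T S F) (x, m, zs) = keep_indicators T R F (x, m, zs)"
    by (simp add: keep_indicators_def)
qed

lemma keep_indicators_self:
  assumes "m \<in> S \<rightarrow>\<^sub>E UNIV"
  shows "keep_indicators S S F (x, m, zs) = F (x, m, zs)"
proof -
  have "{m'. m' \<in> S \<rightarrow>\<^sub>E UNIV \<and> restrict m' S = m} = {m}"
    using assms by auto
  then show ?thesis
    by (simp add: keep_indicators_def)
qed

lemma nn_integral_keep_indicators:
  assumes "finite S" "R \<subseteq> S" "a \<le> p" and sf: "\<And>j. j \<in> {1..p} \<Longrightarrow> sigma_finite_measure (\<mu> j)"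
    and F: "F \<in> borel_measurable (mixed_space \<mu> p a S b)"
  shows "(\<integral>\<^sup>+ s. keep_indicators S R F s \<partial>mixed_space \<mu> p a R b) = (\<integral>\<^sup>+ s. F s \<partial>mixed_space \<mu> p a S b)"
proof -
  have R: "finite R"
    using assms(1,2) by (rule finite_subset[rotated])
  interpret Z: sigma_finite_measure "mat_space \<mu> {b<..p}"
    using sf by (intro sigma_finite_mat_space) auto
  have F'[measurable]: "F \<in> borel_measurable (PiM {1..a} \<mu> \<Otimes>\<^sub>M (ind_space S \<Otimes>\<^sub>M mat_space \<mu> {b<..p}))"
    using F by (simp add: mixed_space_def)
  have "(\<integral>\<^sup>+ m. \<integral>\<^sup>+ zs. keep_indicators S R F (x, m, zs) \<partial>mat_space \<mu> {b<..p} \<partial>ind_space R) =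
      (\<integral>\<^sup>+ m. \<integral>\<^sup>+ zs. F (x, m, zs) \<partial>mat_space \<mu> {b<..p} \<partial>ind_space S)"
    if x: "x \<in> space (PiM {1..a} \<mu>)" for x
  proof -
    have meas: "(\<lambda>zs. F (x, m, zs)) \<in> borel_measurable (mat_space \<mu> {b<..p})" if "m \<in> S \<rightarrow>\<^sub>E UNIV" for m
    proof -
      have "m \<in> space (ind_space S)"
        using that by (simp add: space_ind_space)
      then show ?thesis
        using x by measurable
    qed
    have "(\<integral>\<^sup>+ m. \<integral>\<^sup>+ zs. keep_indicators S R F (x, m, zs) \<partial>mat_space \<mu> {b<..p} \<partial>ind_space R) =
        (\<Sum>m\<in>R \<rightarrow>\<^sub>E UNIV. \<Sum>m'\<in>{m'\<in>S \<rightarrow>\<^sub>E UNIV. restrict m' R = m}. \<integral>\<^sup>+ zs. F (x, m', zs) \<partial>mat_space \<mu> {b<..p})"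
      unfolding nn_integral_ind_space[OF R]
      by (intro sum.cong refl) (auto simp: keep_indicators_def intro!: nn_integral_sum meas)
    also have "\<dots> = (\<Sum>m\<in>S \<rightarrow>\<^sub>E UNIV. \<integral>\<^sup>+ zs. F (x, m, zs) \<partial>mat_space \<mu> {b<..p})"
      using assms(1,2) R by (intro sum.group) (auto intro: finite_patterns)
    finally show ?thesis
      by (simp add: nn_integral_ind_space assms(1))
  qed
  then have "(\<integral>\<^sup>+ x. \<integral>\<^sup>+ m. \<integral>\<^sup>+ zs. keep_indicators S R F (x, m, zs) \<partial>mat_space \<mu> {b<..p} \<partial>ind_space R \<partial>PiM {1..a} \<mu>) =
      (\<integral>\<^sup>+ x. \<integral>\<^sup>+ m. \<integral>\<^sup>+ zs. F (x, m, zs) \<partial>mat_space \<mu> {b<..p} \<partial>ind_space S \<partial>PiM {1..a} \<mu>)"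
    by (rule nn_integral_cong)
  then show ?thesis
    using nn_integral_mixed_space[OF R assms(3) sf keep_indicators_measurable[OF assms(1) F]]
      nn_integral_mixed_space[OF assms(1,3) sf F] by simp
qed

text \<open>The indicators of \<open>B\<close> are all kept, so a pattern in the sum is determined by its part on \<open>I\<close>.\<close>
lemma keep_indicators_merge:
  assumes "finite I" and disj: "I \<inter> B = {}" and R: "R \<subseteq> I" and m: "m \<in> R \<union> B \<rightarrow>\<^sub>E UNIV"
  shows "keep_indicators (I \<union> B) (R \<union> B) G (x, m, zs) =
    (\<Sum>m' | m' \<in> I \<rightarrow>\<^sub>E UNIV \<and> restrict m' R = restrict m R. G (x, merge I B (m', m), zs))"
  unfolding keep_indicators_def prod.case
proof (rule sum.reindex_bij_witness[of _ "\<lambda>m'. merge I B (m', m)" "\<lambda>m'. restrict m' I"])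
  fix m' assume a: "m' \<in> {m'. m' \<in> I \<union> B \<rightarrow>\<^sub>E UNIV \<and> restrict m' (R \<union> B) = m}"
  then have m': "m' \<in> extensional (I \<union> B)" and m_eq: "m = restrict m' (R \<union> B)"
    by (auto simp: PiE_def)
  show "merge I B (restrict m' I, m) = m'"
    using disj m' unfolding m_eq by (auto simp: merge_def fun_eq_iff extensional_def)
  then show "G (x, merge I B (restrict m' I, m), zs) = G (x, m', zs)"
    by simp
  show "restrict m' I \<in> {m'. m' \<in> I \<rightarrow>\<^sub>E UNIV \<and> restrict m' R = restrict m R}"
    using a R unfolding m_eq by (auto simp: restrict_def fun_eq_iff)
next
  fix m' assume a: "m' \<in> {m'. m' \<in> I \<rightarrow>\<^sub>E UNIV \<and> restrict m' R = restrict m R}"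
  then show "restrict (merge I B (m', m)) I = m'"
    by (auto simp: merge_def fun_eq_iff PiE_def extensional_def)
  have eq: "m' j = m j" if "j \<in> R" for j
    using a that by (auto simp: restrict_def fun_eq_iff) metis+
  have ext: "m \<in> extensional (R \<union> B)"
    using m by (auto simp: PiE_def)
  show "merge I B (m', m) \<in> {m'. m' \<in> I \<union> B \<rightarrow>\<^sub>E UNIV \<and> restrict m' (R \<union> B) = m}"
  proof (intro CollectI conjI)
    show "restrict (merge I B (m', m)) (R \<union> B) = m"
      using eq R disj ext by (auto simp: merge_def fun_eq_iff restrict_def extensional_def)
  qed (auto simp: merge_def PiE_def extensional_def)
qed

section \<open>Filling in the missing entries of one block\<close>

text \<open>The factor \<open>q / g\<close> in \<open>G'\<close> is the conditional density of the missing entries of the block, given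
  its materialized values and the conditioning variables. Integrating the missing entries out turns
  \<open>q\<close> into \<open>g\<close>, and the quotient cancels, which leaves \<open>G\<close>. Among the earlier indicators, \<open>q / g\<close>
  depends on those in \<open>R\<close> only, so it factors out of the sum over the others; the sum turns \<open>G\<close>
  into \<open>h = g * H\<close> and leaves \<open>q * H\<close>, where \<open>H\<close> is the marginal density of the conditioning
  variables.\<close>
lemma extend_block:
  fixes \<mu> :: "nat \<Rightarrow> 'a measure" and p a b :: nat and R S :: "nat set"
    and g :: "'a mixed \<Rightarrow> (nat \<Rightarrow> 'a option) \<Rightarrow> ennreal"
    and q :: "'a mixed \<Rightarrow> (nat \<Rightarrow> 'a) \<times> (nat \<Rightarrow> bool) \<Rightarrow> ennreal"
    and h G :: "'a mixed \<times> (nat \<Rightarrow> 'a option) \<Rightarrow> ennreal"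
  defines "C U \<equiv> mixed_space \<mu> p a U b"
    and "Nf \<equiv> full_space \<mu> {a<..b}" and "Ns \<equiv> mat_space \<mu> {a<..b}"
    and "G' \<equiv> \<lambda>((x, m, zs), n). G ((x, m, zs), materialize {a<..b} n) *
           (q (x, restrict m R, zs) n / g (x, restrict m R, zs) (materialize {a<..b} n))"
  assumes sf: "\<And>j. j \<in> {1..p} \<Longrightarrow> sigma_finite_measure (\<mu> j)"
    and ab: "a \<le> b" "b \<le> p" and S: "finite S" and RS: "R \<subseteq> S"
    and g: "is_conditional_of (C R) Ns h g"
    and q: "is_cond_density (C R) Nf q"
    and imp: "AE (c, ys) in C R \<Otimes>\<^sub>M Ns. implied \<mu> {a<..b} (q c) ys = g c ys"
    and G: "G \<in> borel_measurable (C S \<Otimes>\<^sub>M Ns)"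
    and sum: "AE ((x, m, zs), ys) in C R \<Otimes>\<^sub>M Ns.
      h ((x, m, zs), ys) = (\<Sum>m' | m' \<in> S \<rightarrow>\<^sub>E UNIV \<and> restrict m' R = m. G ((x, m', zs), ys))"
  shows "G' \<in> borel_measurable (C S \<Otimes>\<^sub>M Nf)"
    and "AE (u, ys) in C S \<Otimes>\<^sub>M Ns. implied \<mu> {a<..b} (\<lambda>n. G' (u, n)) ys = G (u, ys)"
    and "AE ((x, m, zs), n) in C R \<Otimes>\<^sub>M Nf.
      (\<Sum>m' | m' \<in> S \<rightarrow>\<^sub>E UNIV \<and> restrict m' R = m. G' ((x, m', zs), n)) =
      q (x, m, zs) n * (\<integral>\<^sup>+ ys. h ((x, m, zs), ys) \<partial>Ns)"
proof -
  let ?B = "{a<..b}"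
  let ?p = "\<lambda>(x, m, zs). (x, restrict m R, zs) :: 'a mixed"
  let ?mat = "materialize ?B :: (nat \<Rightarrow> 'a) \<times> (nat \<Rightarrow> bool) \<Rightarrow> nat \<Rightarrow> 'a option"
  have R: "finite R"
    using RS S by (rule finite_subset)
  have sfB: "\<And>j. j \<in> ?B \<Longrightarrow> sigma_finite_measure (\<mu> j)"
    using sf ab by auto
  have sfC: "sigma_finite_measure (C R)" "sigma_finite_measure (C S)"
    unfolding C_def using R S ab sf by (auto intro!: sigma_finite_mixed_space)
  interpret Nf: sigma_finite_measure Nf
    unfolding Nf_def by (rule sigma_finite_full_space[OF _ sfB]) simp_all
  interpret Ns: sigma_finite_measure Ns
    unfolding Ns_def by (rule sigma_finite_mat_space[OF _ sfB]) simp_all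
  interpret RN: pair_sigma_finite "C R" Ns
    using sfC Ns.sigma_finite_measure_axioms by (simp add: pair_sigma_finite_def)
  have p: "nonsingular_map (C S) (C R) ?p"
    unfolding C_def using ab RS by (intro nonsingular_indicators[OF S R _ sf]) auto
  have mat: "nonsingular_map Nf Ns ?mat"
    unfolding Nf_def Ns_def by (rule nonsingular_materialize[OF _ sfB]) simp_all
  have gm: "(\<lambda>w. g (fst w) (snd w)) \<in> borel_measurable (C R \<Otimes>\<^sub>M Ns)"
    and qm: "(\<lambda>w. q (fst w) (snd w)) \<in> borel_measurable (C R \<Otimes>\<^sub>M Nf)"
    using g q by (auto simp: is_conditional_of_def is_cond_density_def split_beta')
  note [measurable] = nonsingular_map_measurable[OF p] nonsingular_map_measurable[OF mat] G
    measurable_compose[OF _ gm, of "\<lambda>w. (f1 w, f2 w)" for f1 f2, unfolded fst_conv snd_conv]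
    measurable_compose[OF _ qm, of "\<lambda>w. (f1 w, f2 w)" for f1 f2, unfolded fst_conv snd_conv]
  have G'_eq: "G' (u, n) = G (u, ?mat n) * (q (?p u) n / g (?p u) (?mat n))" for u n
    by (cases u) (simp add: G'_def)
  have G'_eq_fun: "G' = (\<lambda>w. G (fst w, ?mat (snd w)) * (q (?p (fst w)) (snd w) / g (?p (fst w)) (?mat (snd w))))"
    by (auto simp: G'_eq)
  show "G' \<in> borel_measurable (C S \<Otimes>\<^sub>M Nf)"
    unfolding G'_eq_fun by measurable

  have H: "AE w in C R \<Otimes>\<^sub>M Ns. h w = g (fst w) (snd w) * (\<integral>\<^sup>+ ys. h (fst w, ys) \<partial>Ns)"
    using g by (auto simp: is_conditional_of_def split_beta')
  have fin: "AE w in C R \<Otimes>\<^sub>M Ns. g (fst w) (snd w) \<noteq> \<infinity>"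
  proof (rule RN.AE_pair_measure)
    have "AE c in C R. (\<integral>\<^sup>+ y. g c y \<partial>Ns) = 1"
      using g by (simp add: is_conditional_of_def is_cond_density_def)
    then show "AE c in C R. AE y in Ns. g (fst (c, y)) (snd (c, y)) \<noteq> \<infinity>"
      using AE_space
    proof eventually_elim
      case (elim c)
      then have "g c \<in> borel_measurable Ns"
        by measurable
      then show ?case
        using elim(1) nn_integral_PInf_AE[of "g c" Ns] by simp
    qed
  qed measurable
  have imp': "AE w in C R \<Otimes>\<^sub>M Ns. implied \<mu> ?B (q (fst w)) (snd w) = g (fst w) (snd w)"
    using imp by (simp add: split_beta')
  have sum': "AE w in C R \<Otimes>\<^sub>M Ns. h w = (\<Sum>m' | m' \<in> S \<rightarrow>\<^sub>E UNIV \<and> restrict m' R = fst (snd (fst w)).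
      G ((fst (fst w), m', snd (snd (fst w))), snd w))"
    using sum by (simp add: split_beta')
  have star: "AE w in C R \<Otimes>\<^sub>M Ns.
     h w = g (fst w) (snd w) * (\<integral>\<^sup>+ ys. h (fst w, ys) \<partial>Ns) \<and> g (fst w) (snd w) \<noteq> \<infinity> \<and>
     implied \<mu> ?B (q (fst w)) (snd w) = g (fst w) (snd w) \<and>
     h w = (\<Sum>m' | m' \<in> S \<rightarrow>\<^sub>E UNIV \<and> restrict m' R = fst (snd (fst w)).
      G ((fst (fst w), m', snd (snd (fst w))), snd w))"
    using H fin imp' sum' by eventually_elim simp
  have fin_ext: "finite {m'. m' \<in> S \<rightarrow>\<^sub>E (UNIV :: bool set) \<and> restrict m' R = m}" for m
    by (rule finite_subset[OF _ finite_patterns[OF S]]) auto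

  have "nonsingular_map (C S \<Otimes>\<^sub>M Ns) (C R \<Otimes>\<^sub>M Ns) (\<lambda>(u, ys). (?p u, ys))"
    by (intro nonsingular_map_pair p nonsingular_map_id sfC Ns.sigma_finite_measure_axioms)
  from AE_nonsingular_map[OF this star] AE_space
  show "AE (u, ys) in C S \<Otimes>\<^sub>M Ns. implied \<mu> ?B (\<lambda>n. G' (u, n)) ys = G (u, ys)"
  proof eventually_elim
    case (elim w)
    obtain x m zs ys where w: "w = ((x, m, zs), ys)"
      by (metis prod.exhaust)
    let ?u = "(x, m, zs)" and ?c = "(x, restrict m R, zs)"
    have u: "?u \<in> space (C S)" and ys: "ys \<in> space Ns"
      using elim(2) by (auto simp: w space_pair_measure)
    have c: "?c \<in> space (C R)"
      using measurable_space[OF nonsingular_map_measurable[OF p] u] by simp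
    have "q ?c \<in> borel_measurable Nf"
      using c by measurable
    then have "implied \<mu> ?B (\<lambda>n. (G (?u, ?mat n) * inverse (g ?c (?mat n))) * q ?c n) ys =
        G (?u, ys) * inverse (g ?c ys) * implied \<mu> ?B (q ?c) ys"
      using ys unfolding Nf_def Ns_def by (intro implied_materialize_mult)
    then have *: "implied \<mu> ?B (\<lambda>n. G' (?u, n)) ys = G (?u, ys) * inverse (g ?c ys) * g ?c ys"
      using elim(1) by (simp add: G'_eq divide_ennreal_def w mult_ac)
    show ?case
    \<comment> \<open>Where \<open>g\<close> vanishes, \<open>G\<close> does as well, being a summand of \<open>h = g * H\<close>.\<close>
    proof (cases "g ?c ys = 0")
      case True
      then have "h (?c, ys) = 0"
        using elim(1) by (simp add: w)
      moreover have "h (?c, ys) = (\<Sum>m' | m' \<in> S \<rightarrow>\<^sub>E UNIV \<and> restrict m' R = restrict m R. G ((x, m', zs), ys))"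
        using elim(1) unfolding w fst_conv snd_conv prod.case by blast
      ultimately have "(\<Sum>m' | m' \<in> S \<rightarrow>\<^sub>E UNIV \<and> restrict m' R = restrict m R. G ((x, m', zs), ys)) = 0"
        by simp
      moreover have "m \<in> S \<rightarrow>\<^sub>E UNIV"
        using u by (simp add: C_def space_mixed_space)
      ultimately have "G (?u, ys) = 0"
        using fin_ext by simp
      then show ?thesis
        using * by (simp add: w)
    next
      case False
      moreover have "g ?c ys \<noteq> \<infinity>"
        using elim(1) by (simp add: w)
      ultimately have "inverse (g ?c ys) * g ?c ys = 1"
        using ennreal_divide_self[of "g ?c ys"] by (simp add: divide_ennreal_def mult.commute less_top)
      then show ?thesis
        using * by (simp add: w mult.assoc)
    qed
  qed

  \<comment> \<open>Zeros of \<open>g\<close>: there \<open>q\<close> has integral \<open>\<integral> implied q = \<integral> g = 0\<close>.\<close>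
  have null: "AE w in C R \<Otimes>\<^sub>M Nf. g (fst w) (?mat (snd w)) = 0 \<longrightarrow> q (fst w) (snd w) = 0"
  proof -
    let ?z = "\<lambda>c ys. if g c ys = 0 then 1 else 0 :: ennreal"
    have qs: "q c \<in> borel_measurable Nf" if "c \<in> space (C R)" for c
      using that by measurable
    have "(\<integral>\<^sup>+ w. ?z (fst w) (?mat (snd w)) * q (fst w) (snd w) \<partial>(C R \<Otimes>\<^sub>M Nf)) =
        (\<integral>\<^sup>+ c. \<integral>\<^sup>+ n. ?z c (?mat n) * q c n \<partial>Nf \<partial>C R)"
      by (subst Nf.nn_integral_fst[symmetric]) simp_all
    also have "\<dots> = (\<integral>\<^sup>+ c. \<integral>\<^sup>+ ys. ?z c ys * implied \<mu> ?B (q c) ys \<partial>Ns \<partial>C R)"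
    proof (intro nn_integral_cong)
      fix c assume c: "c \<in> space (C R)"
      have "(\<lambda>n. ?z c (?mat n) * q c n) \<in> borel_measurable Nf"
        using c by measurable
      then have "(\<integral>\<^sup>+ n. ?z c (?mat n) * q c n \<partial>Nf) = (\<integral>\<^sup>+ ys. implied \<mu> ?B (\<lambda>n. ?z c (?mat n) * q c n) ys \<partial>Ns)"
        unfolding Nf_def Ns_def by (intro nn_integral_implied[symmetric] sfB) auto
      also have "\<dots> = (\<integral>\<^sup>+ ys. ?z c ys * implied \<mu> ?B (q c) ys \<partial>Ns)"
        using qs[OF c] unfolding Nf_def Ns_def by (intro nn_integral_cong implied_materialize_mult)
      finally show "(\<integral>\<^sup>+ n. ?z c (?mat n) * q c n \<partial>Nf) = (\<integral>\<^sup>+ ys. ?z c ys * implied \<mu> ?B (q c) ys \<partial>Ns)" .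
    qed
    also have "\<dots> = (\<integral>\<^sup>+ c. \<integral>\<^sup>+ ys. 0 \<partial>Ns \<partial>C R)"
    proof (intro nn_integral_cong_AE)
      have "AE c in C R. AE ys in Ns. implied \<mu> ?B (q c) ys = g c ys"
        using RN.AE_pair[OF imp'] by simp
      then show "AE c in C R. (\<integral>\<^sup>+ ys. ?z c ys * implied \<mu> ?B (q c) ys \<partial>Ns) = (\<integral>\<^sup>+ ys. 0 \<partial>Ns)"
      proof eventually_elim
        case (elim c)
        then show ?case
          by (intro nn_integral_cong_AE) auto
      qed
    qed
    finally have "(\<integral>\<^sup>+ w. ?z (fst w) (?mat (snd w)) * q (fst w) (snd w) \<partial>(C R \<Otimes>\<^sub>M Nf)) = 0"
      by simp
    then have "AE w in C R \<Otimes>\<^sub>M Nf. ?z (fst w) (?mat (snd w)) * q (fst w) (snd w) = 0"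
      by (subst (asm) nn_integral_0_iff_AE) measurable
    then show ?thesis
      by eventually_elim (auto split: if_splits)
  qed
  have "nonsingular_map (C R \<Otimes>\<^sub>M Nf) (C R \<Otimes>\<^sub>M Ns) (\<lambda>(c, n). (c, ?mat n))"
    by (intro nonsingular_map_pair mat nonsingular_map_id sfC Ns.sigma_finite_measure_axioms
        Nf.sigma_finite_measure_axioms)
  from AE_nonsingular_map[OF this star] null
  show "AE ((x, m, zs), n) in C R \<Otimes>\<^sub>M Nf.
      (\<Sum>m' | m' \<in> S \<rightarrow>\<^sub>E UNIV \<and> restrict m' R = m. G' ((x, m', zs), n)) =
      q (x, m, zs) n * (\<integral>\<^sup>+ ys. h ((x, m, zs), ys) \<partial>Ns)"
  proof eventually_elim
    case (elim w)
    obtain x m zs n where w: "w = ((x, m, zs), n)"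
      by (metis prod.exhaust)
    let ?c = "(x, m, zs)" and ?E = "{m'. m' \<in> S \<rightarrow>\<^sub>E UNIV \<and> restrict m' R = m}"
    let ?H = "\<integral>\<^sup>+ ys. h (?c, ys) \<partial>Ns" and ?r = "q ?c n / g ?c (?mat n)"
    have "(\<Sum>m'\<in>?E. G' ((x, m', zs), n)) = (\<Sum>m'\<in>?E. G ((x, m', zs), ?mat n) * ?r)"
      by (intro sum.cong) (auto simp: G'_eq)
    also have "\<dots> = h (?c, ?mat n) * ?r"
    proof -
      have "h (?c, ?mat n) = (\<Sum>m'\<in>?E. G ((x, m', zs), ?mat n))"
        using elim(1) unfolding w fst_conv snd_conv prod.case by blast
      then show ?thesis
        by (simp only: sum_distrib_right)
    qed
    also have "\<dots> = g ?c (?mat n) * ?H * ?r"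
    proof -
      have "h (?c, ?mat n) = g ?c (?mat n) * ?H"
        using elim(1) unfolding w fst_conv snd_conv prod.case by blast
      then show ?thesis
        by (simp only:)
    qed
    also have "\<dots> = q ?c n * ?H"
    proof (cases "g ?c (?mat n) = 0")
      case True
      then show ?thesis
        using elim(2) by (simp add: w)
    next
      case False
      moreover have "g ?c (?mat n) \<noteq> \<infinity>"
        using elim(1) by (simp add: w)
      ultimately have "g ?c (?mat n) * inverse (g ?c (?mat n)) = 1"
        using ennreal_divide_self[of "g ?c (?mat n)"] by (simp add: divide_ennreal_def less_top)
      then have "q ?c n * ?H * (g ?c (?mat n) * inverse (g ?c (?mat n))) = q ?c n * ?H"
        by simp
      then show ?thesis
        by (simp only: divide_ennreal_def mult_ac)
    qed
    finally show ?case
      by (simp add: w)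
  qed
qed

section \<open>The sequential construction\<close>

lemma merge_assoc: "merge I (J \<union> L) (x, merge J L (y, z)) = merge (I \<union> J) L (merge I J (x, y), z)"
  by (auto simp: merge_def fun_eq_iff)

lemma merge_empty_left: "merge {} I (x, y) = restrict y I"
  by (auto simp: merge_def)

locale sequential_identification =
  fixes \<mu> :: "nat \<Rightarrow> 'a measure"
    and p K :: nat
    and t :: "nat \<Rightarrow> nat"
    and R :: "nat \<Rightarrow> nat set"
    and A :: "nat \<Rightarrow> ('a mixed \<Rightarrow> (nat \<Rightarrow> 'a option) \<Rightarrow> ennreal) \<Rightarrow>
                'a mixed \<Rightarrow> (nat \<Rightarrow> 'a) \<times> (nat \<Rightarrow> bool) \<Rightarrow> ennreal"
    and D :: "nat \<Rightarrow> ('a mixed \<times> (nat \<Rightarrow> 'a option) \<Rightarrow> ennreal) \<Rightarrow>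
                'a mixed \<Rightarrow> (nat \<Rightarrow> 'a option) \<Rightarrow> ennreal"
    and f :: "(nat \<Rightarrow> 'a option) \<Rightarrow> ennreal"
  assumes sf: "\<And>j. j \<in> {1..p} \<Longrightarrow> sigma_finite_measure (\<mu> j)"
    and t0: "t 0 = 0" and tK: "t K = p" and t_less: "\<And>k. k < K \<Longrightarrow> t k < t (Suc k)"
    and R0: "R 0 = {}" and R_sub: "\<And>k. k \<in> {1..<K} \<Longrightarrow> R k \<subseteq> block t k \<union> R (k - 1)"
    and ident: "\<And>k. k \<in> {1..K} \<Longrightarrow> identifying_assumption \<mu> p t R k (A k)"
    and version: "version_choice \<mu> p t R K D"
    and f: "is_density (mat_space \<mu> {1..p}) f"
begin

abbreviation seq :: "nat \<Rightarrow> 'a mixed \<Rightarrow> ennreal" where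
  "seq \<equiv> seq_density \<mu> p t R A D f"

text \<open>The assumption for block \<open>Suc k\<close> is applied to the conditional density, chosen by \<open>D\<close>, of this
  joint density.\<close>
definition joint :: "nat \<Rightarrow> 'a mixed \<times> (nat \<Rightarrow> 'a option) \<Rightarrow> ennreal" where
  "joint k = split_block p t (Suc k) (keep_indicators (step_inds t R k) (R k) (seq k))"

abbreviation completed_density ::
  "nat \<Rightarrow> 'a mixed \<Rightarrow> (nat \<Rightarrow> 'a) \<times> (nat \<Rightarrow> bool) \<Rightarrow> ennreal" where
  "completed_density k \<equiv> A (Suc k) (D (Suc k) (joint k))"

lemma block_Suc: "block t (Suc k) = {t k<..t (Suc k)}"
  by (simp add: block_def)

lemma given_space_Suc: "given_space \<mu> p t R (Suc k) = mixed_space \<mu> p (t k) (R k) (t (Suc k))"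
  by (simp add: given_space_def)

lemma joint_eq: "joint k v = keep_indicators (step_inds t R k) (R k) (seq k) (join_star {t k<..t (Suc k)} {t (Suc k)<..p} v)"
  by (simp add: joint_def split_block_def join_star_def block_Suc split_beta')

lemma t_mono: "i \<le> j \<Longrightarrow> j \<le> K \<Longrightarrow> t i \<le> t j"
proof (induction j rule: dec_induct)
  case (step n)
  then show ?case
    using t_less[of n] by simp
qed simp

lemma t_le_p: "k \<le> K \<Longrightarrow> t k \<le> p"
  using t_mono[of k K] tK by simp

lemma step_inds_Suc: "step_inds t R (Suc k) = R k \<union> {t k<..t (Suc k)}"
  by (simp add: step_inds_def block_Suc)

lemma R_subset_step_inds: "k < K \<Longrightarrow> R k \<subseteq> step_inds t R k"
  using R_sub[of k] R0 by (cases k) (auto simp: step_inds_def)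

lemma step_inds_subset: "k \<le> K \<Longrightarrow> step_inds t R k \<subseteq> {1..t k}"
proof (induction k)
  case (Suc k)
  then show ?case
    using R_subset_step_inds[of k] t_less[of k] by (fastforce simp: step_inds_Suc)
qed (simp add: step_inds_def)

lemma R_subset: "k < K \<Longrightarrow> R k \<subseteq> {1..t k}"
  using R_subset_step_inds[of k] step_inds_subset[of k] by simp

lemma finite_step_inds: "k \<le> K \<Longrightarrow> finite (step_inds t R k)"
  using step_inds_subset by (rule finite_subset) simp_all

lemma finite_R: "k < K \<Longrightarrow> finite (R k)"
  using R_subset by (rule finite_subset) simp_all

lemma seq_Suc:
  "seq (Suc k) s = (case cut_full {1..t k} (R k) {t k<..t (Suc k)} s of
     (c, n) \<Rightarrow> completed_density k c n * (\<integral>\<^sup>+ ys. joint k (c, ys) \<partial>mat_space \<mu> {t k<..t (Suc k)}))"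
  by (simp add: cut_full_def joint_def block_Suc Let_def split_beta')

lemma joint_is_density:
  assumes k: "k < K" and F: "is_density (mixed_space \<mu> p (t k) (step_inds t R k) (t k)) (seq k)"
  shows "is_density (given_space \<mu> p t R (Suc k) \<Otimes>\<^sub>M mat_space \<mu> (block t (Suc k))) (joint k)"
proof -
  let ?M = "mixed_space \<mu> p (t k) (R k) (t k)"
  have le: "t k \<le> t (Suc k)" "t (Suc k) \<le> p" "t k \<le> p"
    using k t_less[of k] t_le_p[of "Suc k"] t_le_p[of k] by auto
  have mp: "measure_preserving (mixed_space \<mu> p (t k) (R k) (t (Suc k)) \<Otimes>\<^sub>M mat_space \<mu> {t k<..t (Suc k)}) ?M
      (join_star {t k<..t (Suc k)} {t (Suc k)<..p})"
    by (rule join_star_preserving[OF finite_R[OF k] le(1,2) sf])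
  have Fm: "seq k \<in> borel_measurable (mixed_space \<mu> p (t k) (step_inds t R k) (t k))"
    using F by (simp add: is_density_def)
  have fin: "finite (step_inds t R k)"
    using k by (intro finite_step_inds) simp
  have keep: "keep_indicators (step_inds t R k) (R k) (seq k) \<in> borel_measurable ?M"
    by (rule keep_indicators_measurable[OF fin Fm])
  have "(\<integral>\<^sup>+ v. joint k v \<partial>(mixed_space \<mu> p (t k) (R k) (t (Suc k)) \<Otimes>\<^sub>M mat_space \<mu> {t k<..t (Suc k)})) = 1"
    unfolding joint_eq nn_integral_measure_preserving[OF mp keep]
    using F nn_integral_keep_indicators[OF fin R_subset_step_inds[OF k] le(3) sf Fm]
    by (simp add: is_density_def)
  moreover have "joint k = (\<lambda>v. keep_indicators (step_inds t R k) (R k) (seq k)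
      (join_star {t k<..t (Suc k)} {t (Suc k)<..p} v))"
    by (simp add: joint_eq fun_eq_iff)
  ultimately show ?thesis
    using measurable_compose[OF measure_preserving_measurable[OF mp] keep]
    by (simp add: is_density_def given_space_Suc block_Suc)
qed

lemma
  assumes k: "k < K" and F: "is_density (mixed_space \<mu> p (t k) (step_inds t R k) (t k)) (seq k)"
  shows version_is_conditional: "is_conditional_of (mixed_space \<mu> p (t k) (R k) (t (Suc k)))
      (mat_space \<mu> {t k<..t (Suc k)}) (joint k) (D (Suc k) (joint k))"
    and completed_is_cond_density: "is_cond_density (mixed_space \<mu> p (t k) (R k) (t (Suc k)))
      (full_space \<mu> {t k<..t (Suc k)}) (completed_density k)"
    and implied_completed: "AE (c, ys) in mixed_space \<mu> p (t k) (R k) (t (Suc k)) \<Otimes>\<^sub>M mat_space \<mu> {t k<..t (Suc k)}.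
      implied \<mu> {t k<..t (Suc k)} (completed_density k c) ys = D (Suc k) (joint k) c ys"
proof -
  show *: "is_conditional_of (mixed_space \<mu> p (t k) (R k) (t (Suc k)))
      (mat_space \<mu> {t k<..t (Suc k)}) (joint k) (D (Suc k) (joint k))"
    using version[unfolded version_choice_def, rule_format, OF _ joint_is_density[OF assms]] k
    by (simp add: given_space_Suc block_Suc)
  have "identifying_assumption \<mu> p t R (Suc k) (A (Suc k))"
    using k by (intro ident) simp
  note rule = this[unfolded identifying_assumption_def given_space_Suc block_Suc, rule_format,
      OF conjunct1[OF *[unfolded is_conditional_of_def]]]
  from rule show "is_cond_density (mixed_space \<mu> p (t k) (R k) (t (Suc k)))
      (full_space \<mu> {t k<..t (Suc k)}) (completed_density k)"
    "AE (c, ys) in mixed_space \<mu> p (t k) (R k) (t (Suc k)) \<Otimes>\<^sub>M mat_space \<mu> {t k<..t (Suc k)}.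
      implied \<mu> {t k<..t (Suc k)} (completed_density k c) ys = D (Suc k) (joint k) c ys"
    by blast+
qed

lemma PiM_no_variables: "PiM {1..0::nat} M = count_space {\<lambda>_. undefined}"
  by (simp add: PiM_empty)

text \<open>Before the first step there are no unstarred variables and no indicators, and the mixed space is
  that of \<open>X*\<close>.\<close>
lemma nn_integral_no_block:
  assumes F: "F \<in> borel_measurable (mixed_space \<mu> p 0 {} 0)"
  shows "(\<integral>\<^sup>+ s. F s \<partial>mixed_space \<mu> p 0 {} 0) =
    (\<integral>\<^sup>+ xs. F (\<lambda>_. undefined, \<lambda>_. undefined, xs) \<partial>mat_space \<mu> {1..p})"
proof -
  have iv: "{0<..p} = {1..p}"
    by auto
  show ?thesis
    using nn_integral_mixed_space[OF finite.emptyI le0 sf F]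
    unfolding PiM_no_variables iv
    by (simp add: nn_integral_count_space_finite nn_integral_ind_space)
qed

text \<open>The completed conditional density integrates to one, so a step of the construction preserves the
  total mass, and \<open>version_choice\<close> applies again at the next step.\<close>
lemma seq_is_density: "k \<le> K \<Longrightarrow> is_density (mixed_space \<mu> p (t k) (step_inds t R k) (t k)) (seq k)"
proof (induction k)
  case 0
  have iv: "{0<..p} = {1..p}"
    by auto
  have [measurable]: "f \<in> borel_measurable (mat_space \<mu> {1..p})"
    using f by (simp add: is_density_def)
  have meas: "(\<lambda>(x, m, xs). f xs) \<in> borel_measurable (mixed_space \<mu> p 0 {} 0)"
    unfolding mixed_space_def iv by measurable
  then show ?case
    using f by (simp add: t0 step_inds_def is_density_def nn_integral_no_block)
next
  case (Suc k)
  let ?B = "{t k<..t (Suc k)}" and ?C = "mixed_space \<mu> p (t k) (R k) (t (Suc k))"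
  let ?M = "mixed_space \<mu> p (t (Suc k)) (R k \<union> {t k<..t (Suc k)}) (t (Suc k))"
  have k: "k < K" and F: "is_density (mixed_space \<mu> p (t k) (step_inds t R k) (t k)) (seq k)"
    using Suc by auto
  have le: "t k \<le> t (Suc k)" "t (Suc k) \<le> p" "t k \<le> p"
    using k t_less[of k] t_le_p[of "Suc k"] t_le_p[of k] by auto
  have disj: "R k \<inter> ?B = {}"
    using R_subset[OF k] by fastforce
  have sfB: "\<And>j. j \<in> ?B \<Longrightarrow> sigma_finite_measure (\<mu> j)"
    using sf le by auto
  interpret Nf: sigma_finite_measure "full_space \<mu> ?B"
    by (rule sigma_finite_full_space[OF _ sfB]) simp_all
  interpret Ns: sigma_finite_measure "mat_space \<mu> ?B"
    by (rule sigma_finite_mat_space[OF _ sfB]) simp_all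
  let ?Q = "\<lambda>v. completed_density k (fst v) (snd v) * (\<integral>\<^sup>+ ys. joint k (fst v, ys) \<partial>mat_space \<mu> ?B)"
  have joint: "joint k \<in> borel_measurable (?C \<Otimes>\<^sub>M mat_space \<mu> ?B)" "(\<integral>\<^sup>+ v. joint k v \<partial>(?C \<Otimes>\<^sub>M mat_space \<mu> ?B)) = 1"
    using joint_is_density[OF k F] by (simp_all add: is_density_def given_space_Suc block_Suc)
  note [measurable] = joint(1)
  have comp: "(\<lambda>v. completed_density k (fst v) (snd v)) \<in> borel_measurable (?C \<Otimes>\<^sub>M full_space \<mu> ?B)"
    "AE c in ?C. (\<integral>\<^sup>+ n. completed_density k c n \<partial>full_space \<mu> ?B) = 1"
    using completed_is_cond_density[OF k F] by (auto simp: is_cond_density_def split_beta')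
  note [measurable] = comp(1)
  have Q: "?Q \<in> borel_measurable (?C \<Otimes>\<^sub>M full_space \<mu> ?B)"
    by measurable
  have cut: "cut_full {1..t k} (R k) ?B \<in> ?M \<rightarrow>\<^sub>M ?C \<Otimes>\<^sub>M full_space \<mu> ?B"
    by (rule cut_full_measurable[OF le(1,2)])
  have mp: "measure_preserving ?M (?C \<Otimes>\<^sub>M full_space \<mu> ?B) (cut_full {1..t k} (R k) ?B)"
    by (rule measure_preserving_inverse[OF join_full_preserving[OF finite_R[OF k] le(1,2) disj sf] cut
          cut_join_full[OF disj]])
  have seq: "seq (Suc k) = (\<lambda>s. ?Q (cut_full {1..t k} (R k) ?B s))"
    by (rule ext) (simp only: seq_Suc split_beta')
  have "(\<integral>\<^sup>+ s. seq (Suc k) s \<partial>?M) = (\<integral>\<^sup>+ v. ?Q v \<partial>(?C \<Otimes>\<^sub>M full_space \<mu> ?B))"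
    unfolding seq by (rule nn_integral_measure_preserving[OF mp Q])
  also have "\<dots> = (\<integral>\<^sup>+ c. \<integral>\<^sup>+ n. completed_density k c n * (\<integral>\<^sup>+ ys. joint k (c, ys) \<partial>mat_space \<mu> ?B) \<partial>full_space \<mu> ?B \<partial>?C)"
    using Nf.nn_integral_fst[OF Q] by simp
  also have "\<dots> = (\<integral>\<^sup>+ c. \<integral>\<^sup>+ ys. joint k (c, ys) \<partial>mat_space \<mu> ?B \<partial>?C)"
  proof (rule nn_integral_cong_AE)
    show "AE c in ?C. (\<integral>\<^sup>+ n. completed_density k c n * (\<integral>\<^sup>+ ys. joint k (c, ys) \<partial>mat_space \<mu> ?B) \<partial>full_space \<mu> ?B) =
      (\<integral>\<^sup>+ ys. joint k (c, ys) \<partial>mat_space \<mu> ?B)"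
      using comp(2) AE_space
    proof eventually_elim
      case (elim c)
      have "completed_density k c \<in> borel_measurable (full_space \<mu> ?B)"
        using measurable_compose[OF measurable_Pair1'[OF elim(2)] comp(1)] by simp
      then show ?case
        using elim(1) by (simp add: nn_integral_multc)
    qed
  qed
  also have "\<dots> = 1"
    using Ns.nn_integral_fst[OF joint(1)] joint(2) by simp
  finally show ?case
    using measurable_compose[OF cut Q] unfolding is_density_def step_inds_Suc seq by simp
qed

text \<open>One step of the extension. The density \<open>G\<close> keeps all the indicators of the blocks up to \<open>k\<close>, whereas
  \<open>seq k\<close> keeps those in \<open>step_inds t R k\<close>; it is obtained from \<open>G\<close> by summing out the rest, and
  the same relation is established for the new density and \<open>seq (Suc k)\<close>. Both claims are those of
  \<open>extend_block\<close>, carried over to mixed spaces by the identifications above.\<close>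
lemma ex_extension:
  assumes k: "k < K"
    and G: "G \<in> borel_measurable (mixed_space \<mu> p (t k) {1..t k} (t k))"
    and keep: "AE s in mixed_space \<mu> p (t k) (step_inds t R k) (t k).
      keep_indicators {1..t k} (step_inds t R k) G s = seq k s"
  shows "\<exists>G'. G' \<in> borel_measurable (mixed_space \<mu> p (t (Suc k)) {1..t (Suc k)} (t (Suc k))) \<and>
    (AE s in mixed_space \<mu> p (t (Suc k)) (step_inds t R (Suc k)) (t (Suc k)).
      keep_indicators {1..t (Suc k)} (step_inds t R (Suc k)) G' s = seq (Suc k) s) \<and>
    (AE (u, ys) in mixed_space \<mu> p (t k) {1..t k} (t (Suc k)) \<Otimes>\<^sub>M mat_space \<mu> {t k<..t (Suc k)}.
      implied \<mu> {t k<..t (Suc k)} (\<lambda>n. G' (join_full {1..t k} {1..t k} {t k<..t (Suc k)} (u, n))) ys =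
      G (join_star {t k<..t (Suc k)} {t (Suc k)<..p} (u, ys)))"
proof -
  let ?I = "{1..t k}" and ?B = "{t k<..t (Suc k)}" and ?Z = "{t (Suc k)<..p}"
  let ?C = "\<lambda>S. mixed_space \<mu> p (t k) S (t (Suc k))"
  note F = seq_is_density[OF less_imp_le[OF k]]
  have le: "t k \<le> t (Suc k)" "t (Suc k) \<le> p" "t k \<le> p"
    using k t_less[of k] t_le_p[of "Suc k"] t_le_p[of k] by auto
  have un: "{1..t (Suc k)} = ?I \<union> ?B"
    using le by auto
  have disj: "?I \<inter> ?B = {}" "R k \<inter> ?B = {}"
    using R_subset[OF k] by fastforce+
  define G0 where "G0 v = G (join_star ?B ?Z v)" for v
  have G0: "G0 \<in> borel_measurable (?C ?I \<Otimes>\<^sub>M mat_space \<mu> ?B)"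
  proof -
    have "join_star ?B ?Z \<in> ?C ?I \<Otimes>\<^sub>M mat_space \<mu> ?B \<rightarrow>\<^sub>M mixed_space \<mu> p (t k) ?I (t k)"
      by (intro measure_preserving_measurable join_star_preserving le(1,2) sf) simp_all
    from measurable_compose[OF this G] show ?thesis
      by (simp add: G0_def[abs_def])
  qed
  \<comment> \<open>\<open>joint k\<close> is \<open>G\<close> with all the indicators outside \<open>R k\<close> summed out.\<close>
  have "AE s in mixed_space \<mu> p (t k) (R k) (t k).
      keep_indicators (step_inds t R k) (R k) (keep_indicators ?I (step_inds t R k) G) s =
      keep_indicators (step_inds t R k) (R k) (seq k) s"
    using k by (intro keep_indicators_cong_AE[OF _ R_subset_step_inds le(3) sf keep] finite_step_inds) auto
  then have "AE s in mixed_space \<mu> p (t k) (R k) (t k).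
      keep_indicators (step_inds t R k) (R k) (seq k) s = keep_indicators ?I (R k) G s"
    using k keep_indicators_trans[OF _ step_inds_subset R_subset_step_inds, of k G]
    by (auto elim: eventually_mono)
  then have "AE v in ?C (R k) \<Otimes>\<^sub>M mat_space \<mu> ?B. joint k v = keep_indicators ?I (R k) G (join_star ?B ?Z v)"
    unfolding joint_eq by (subst (asm) AE_join_star_iff[OF finite_R[OF k] le(1,2) sf])
  then have sum: "AE ((x, m, zs), ys) in ?C (R k) \<Otimes>\<^sub>M mat_space \<mu> ?B.
      joint k ((x, m, zs), ys) = (\<Sum>m' | m' \<in> ?I \<rightarrow>\<^sub>E UNIV \<and> restrict m' (R k) = m. G0 ((x, m', zs), ys))"
    by (simp add: split_beta' join_star_def keep_indicators_def G0_def)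
  define G1 where "G1 = (\<lambda>((x, m, zs), n). G0 ((x, m, zs), materialize ?B n) *
      (completed_density k (x, restrict m (R k), zs) n /
       D (Suc k) (joint k) (x, restrict m (R k), zs) (materialize ?B n)))"
  note extend = extend_block[OF _ le(1,2) finite_atLeastAtMost R_subset[OF k] version_is_conditional[OF k F]
      completed_is_cond_density[OF k F] implied_completed[OF k F] G0 sum, folded G1_def]
  have G1: "G1 \<in> borel_measurable (?C ?I \<Otimes>\<^sub>M full_space \<mu> ?B)"
    by (rule extend(1)[OF sf])
  have implied_G1: "AE (u, ys) in ?C ?I \<Otimes>\<^sub>M mat_space \<mu> ?B. implied \<mu> ?B (\<lambda>n. G1 (u, n)) ys = G0 (u, ys)"
    by (rule extend(2)[OF sf])
  have sum_G1: "AE ((x, m, zs), n) in ?C (R k) \<Otimes>\<^sub>M full_space \<mu> ?B.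
      (\<Sum>m' | m' \<in> ?I \<rightarrow>\<^sub>E UNIV \<and> restrict m' (R k) = m. G1 ((x, m', zs), n)) =
      completed_density k (x, m, zs) n * (\<integral>\<^sup>+ ys. joint k ((x, m, zs), ys) \<partial>mat_space \<mu> ?B)"
    by (rule extend(3)[OF sf])
  define G' where "G' s = G1 (cut_full ?I ?I ?B s)" for s
  have G'_join: "G' (join_full ?I ?I ?B v) = G1 v" if "v \<in> space (?C ?I \<Otimes>\<^sub>M full_space \<mu> ?B)" for v
    using cut_join_full[OF disj(1) that] by (simp add: G'_def)
  have "G' \<in> borel_measurable (mixed_space \<mu> p (t (Suc k)) {1..t (Suc k)} (t (Suc k)))"
    using measurable_compose[OF cut_full_measurable[OF le(1,2)] G1] un
    by (simp add: G'_def[abs_def])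
  moreover have "AE v in ?C (R k) \<Otimes>\<^sub>M full_space \<mu> ?B.
      keep_indicators {1..t (Suc k)} (R k \<union> ?B) G' (join_full ?I (R k) ?B v) = seq (Suc k) (join_full ?I (R k) ?B v)"
    using sum_G1 AE_space
  proof eventually_elim
    case (elim v)
    obtain x m zs y n where v: "v = ((x, m, zs), (y, n))"
      by (metis prod.exhaust)
    have sp: "m \<in> R k \<rightarrow>\<^sub>E UNIV" "n \<in> ?B \<rightarrow>\<^sub>E UNIV" "x \<in> space (PiM ?I \<mu>)" "y \<in> space (PiM ?B \<mu>)"
      "zs \<in> space (mat_space \<mu> ?Z)"
      using elim(2) by (auto simp: v space_pair_measure space_mixed_space space_full_space)
    have mn: "merge (R k) ?B (m, n) \<in> R k \<union> ?B \<rightarrow>\<^sub>E UNIV" "restrict (merge (R k) ?B (m, n)) (R k) = m"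
      using sp(1) by (auto simp: merge_def PiE_def extensional_def fun_eq_iff)
    have "keep_indicators {1..t (Suc k)} (R k \<union> ?B) G' (join_full ?I (R k) ?B v) =
        (\<Sum>m' | m' \<in> ?I \<rightarrow>\<^sub>E UNIV \<and> restrict m' (R k) = m.
          G' (merge ?I ?B (x, y), merge ?I ?B (m', merge (R k) ?B (m, n)), zs))"
      unfolding v join_full_def un split
      using keep_indicators_merge[OF _ disj(1) R_subset[OF k] mn(1)] mn(2) by simp
    also have "\<dots> = (\<Sum>m' | m' \<in> ?I \<rightarrow>\<^sub>E UNIV \<and> restrict m' (R k) = m. G1 ((x, m', zs), (y, n)))"
    proof (rule sum.cong[OF refl])
      fix m' assume m': "m' \<in> {m'. m' \<in> ?I \<rightarrow>\<^sub>E UNIV \<and> restrict m' (R k) = m}"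
      have "merge ?I ?B (m', merge (R k) ?B (m, n)) = merge ?I ?B (m', n)"
        using disj(2) by (auto simp: merge_def fun_eq_iff)
      then have "(merge ?I ?B (x, y), merge ?I ?B (m', merge (R k) ?B (m, n)), zs) =
          join_full ?I ?I ?B ((x, m', zs), (y, n))"
        by (simp add: join_full_def)
      also have "G' \<dots> = G1 ((x, m', zs), (y, n))"
        using sp m' by (intro G'_join) (auto simp: space_pair_measure space_mixed_space space_full_space)
      finally show "G' (merge ?I ?B (x, y), merge ?I ?B (m', merge (R k) ?B (m, n)), zs) = G1 ((x, m', zs), (y, n))" .
    qed
    also have "\<dots> = seq (Suc k) (join_full ?I (R k) ?B v)"
      unfolding seq_Suc cut_join_full[OF disj(2) elim(2)] using elim(1) by (simp add: v)
    finally show ?case .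
  qed
  then have "AE s in mixed_space \<mu> p (t (Suc k)) (step_inds t R (Suc k)) (t (Suc k)).
      keep_indicators {1..t (Suc k)} (step_inds t R (Suc k)) G' s = seq (Suc k) s"
    unfolding step_inds_Suc by (subst AE_join_full_iff[OF finite_R[OF k] le(1,2) disj(2) sf]) auto
  moreover have "AE (u, ys) in ?C ?I \<Otimes>\<^sub>M mat_space \<mu> ?B.
      implied \<mu> ?B (\<lambda>n. G' (join_full ?I ?I ?B (u, n))) ys = G (join_star ?B ?Z (u, ys))"
  proof -
    have "AE w in ?C ?I \<Otimes>\<^sub>M mat_space \<mu> ?B. implied \<mu> ?B (\<lambda>n. G1 (fst w, n)) (snd w) = G (join_star ?B ?Z w)"
      using implied_G1 by (simp add: G0_def split_beta')
    then have "AE w in ?C ?I \<Otimes>\<^sub>M mat_space \<mu> ?B.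
      implied \<mu> ?B (\<lambda>n. G' (join_full ?I ?I ?B (fst w, n))) (snd w) = G (join_star ?B ?Z w)"
      using AE_space
    proof eventually_elim
      case (elim w)
      then have w: "fst w \<in> space (?C ?I)" "snd w \<in> space (mat_space \<mu> ?B)"
        by (auto simp: space_pair_measure)
      have "implied \<mu> ?B (\<lambda>n. G' (join_full ?I ?I ?B (fst w, n))) (snd w) = implied \<mu> ?B (\<lambda>n. G1 (fst w, n)) (snd w)"
        unfolding implied_fill
        using w measurable_space[OF fill_measurable[OF w(2)]]
        by (intro nn_integral_cong G'_join) (simp add: space_pair_measure)
      then show ?case
        using elim(1) by simp
    qed
    then show ?thesis
      by (simp add: split_beta')
  qed
  ultimately show ?thesis
    by blast
qed

lemma ex_extension_sequence:
  "\<exists>G. (\<forall>k\<le>K. G k \<in> borel_measurable (mixed_space \<mu> p (t k) {1..t k} (t k)) \<and>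
      (AE s in mixed_space \<mu> p (t k) (step_inds t R k) (t k).
        keep_indicators {1..t k} (step_inds t R k) (G k) s = seq k s)) \<and>
    (\<forall>k<K. AE (u, ys) in mixed_space \<mu> p (t k) {1..t k} (t (Suc k)) \<Otimes>\<^sub>M mat_space \<mu> {t k<..t (Suc k)}.
      implied \<mu> {t k<..t (Suc k)} (\<lambda>n. G (Suc k) (join_full {1..t k} {1..t k} {t k<..t (Suc k)} (u, n))) ys =
      G k (join_star {t k<..t (Suc k)} {t (Suc k)<..p} (u, ys))) \<and>
    G 0 = seq 0"
proof -
  let ?P = "\<lambda>k G. (k = 0 \<longrightarrow> G = seq 0) \<and> (k \<le> K \<longrightarrow> G \<in> borel_measurable (mixed_space \<mu> p (t k) {1..t k} (t k)) \<and>
      (AE s in mixed_space \<mu> p (t k) (step_inds t R k) (t k).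
        keep_indicators {1..t k} (step_inds t R k) G s = seq k s))"
  let ?Q = "\<lambda>k G G'. k < K \<longrightarrow> (AE (u, ys) in mixed_space \<mu> p (t k) {1..t k} (t (Suc k)) \<Otimes>\<^sub>M mat_space \<mu> {t k<..t (Suc k)}.
      implied \<mu> {t k<..t (Suc k)} (\<lambda>n. G' (join_full {1..t k} {1..t k} {t k<..t (Suc k)} (u, n))) ys =
      G (join_star {t k<..t (Suc k)} {t (Suc k)<..p} (u, ys)))"
  have "\<exists>G. \<forall>k. ?P k (G k) \<and> ?Q k (G k) (G (Suc k))"
  proof (rule dependent_nat_choice)
    have "?P 0 (seq 0)"
      using seq_is_density[of 0]
      by (auto simp: t0 step_inds_def is_density_def space_mixed_space keep_indicators_self intro!: AE_I2)
    then show "\<exists>G. ?P 0 G"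
      by blast
  next
    fix G k assume "?P k G"
    then show "\<exists>G'. ?P (Suc k) G' \<and> ?Q k G G'"
      using ex_extension[of k G] by (cases "k < K") auto
  qed
  then show ?thesis
    by auto
qed

text \<open>The density of \<open>(X\<^bsub>{1..b}\<^esub>, M\<^bsub>{1..b}\<^esub>, X*\<^bsub>{b<..p}\<^esub>)\<close> implied by \<open>h\<close>. It differs from
  \<open>implied_mixed\<close> in that all the indicators are kept.\<close>
definition implied_prefix :: "((nat \<Rightarrow> 'a) \<times> (nat \<Rightarrow> bool) \<Rightarrow> ennreal) \<Rightarrow> nat \<Rightarrow> 'a mixed \<Rightarrow> ennreal" where
  "implied_prefix h b = (\<lambda>(x, m, xs). implied \<mu> {b<..p}
     (\<lambda>(y, n). h (merge {1..b} {b<..p} (x, y), merge {1..b} {b<..p} (m, n))) xs)"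

lemma implied_mixed_eq: "implied_mixed \<mu> p b S h = keep_indicators {1..b} S (implied_prefix h b)"
  by (simp add: implied_mixed_def implied_prefix_def)

text \<open>The missing entries after position \<open>a\<close> can be integrated out in two stages, first those after \<open>b\<close>,
  then those of the block \<open>{a<..b}\<close>.\<close>
lemma implied_prefix_join_star:
  assumes ab: "a \<le> b" "b \<le> p" and h: "h \<in> borel_measurable (full_space \<mu> {1..p})"
    and w: "(u, ys) \<in> space (mixed_space \<mu> p a {1..a} b \<Otimes>\<^sub>M mat_space \<mu> {a<..b})"
  shows "implied_prefix h a (join_star {a<..b} {b<..p} (u, ys)) =
    implied \<mu> {a<..b} (\<lambda>n. implied_prefix h b (join_full {1..a} {1..a} {a<..b} (u, n))) ys"
proof -
  let ?I = "{1..a}" and ?B = "{a<..b}" and ?Z = "{b<..p}"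
  obtain x m zs where u: "u = (x, m, zs)"
    by (metis prod.exhaust)
  have sp: "x \<in> space (PiM ?I \<mu>)" "m \<in> ?I \<rightarrow>\<^sub>E UNIV" "zs \<in> space (mat_space \<mu> ?Z)" "ys \<in> space (mat_space \<mu> ?B)"
    using w by (auto simp: u space_pair_measure space_mixed_space)
  have un: "{a<..p} = ?B \<union> ?Z" "{1..p} = ?I \<union> (?B \<union> ?Z)" "{1..b} = ?I \<union> ?B"
    using ab by auto
  let ?\<phi> = "\<lambda>(y, n). h (merge ?I (?B \<union> ?Z) (x, y), merge ?I (?B \<union> ?Z) (m, n))"
  have \<phi>: "?\<phi> \<in> borel_measurable (full_space \<mu> (?B \<union> ?Z))"
  proof -
    note [measurable] = merge_bool_measurable[of ?I "?B \<union> ?Z", simplified]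
    have "(\<lambda>(y, n). (merge ?I (?B \<union> ?Z) (x, y), merge ?I (?B \<union> ?Z) (m, n))) \<in>
        full_space \<mu> (?B \<union> ?Z) \<rightarrow>\<^sub>M full_space \<mu> {1..p}"
      using sp(1,2) unfolding full_space_def un(2) by (simp add: space_ind_space)
    from measurable_compose[OF this h] show ?thesis
      by (simp add: split_beta')
  qed
  have xs: "merge ?B ?Z (ys, zs) \<in> space (mat_space \<mu> (?B \<union> ?Z))"
    using sp(3,4) measurable_space[OF merge_mat_measurable] by (force simp: space_pair_measure)
  have res: "restrict (merge ?B ?Z (ys, zs)) ?B = ys" "restrict (merge ?B ?Z (ys, zs)) ?Z = zs"
    using sp(3,4) by (auto simp: in_space_mat_space merge_def fun_eq_iff extensional_def)
  have "implied \<mu> (?B \<union> ?Z) ?\<phi> (merge ?B ?Z (ys, zs)) =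
      implied \<mu> ?B (\<lambda>(y, n). implied \<mu> ?Z (\<lambda>(y', n'). ?\<phi> (merge ?B ?Z (y, y'), merge ?B ?Z (n, n'))) zs) ys"
    using sf ab by (subst implied_union[OF _ _ _ _ \<phi> xs]) (auto simp: res)
  also have "\<dots> = implied \<mu> ?B (\<lambda>n. implied_prefix h b (join_full ?I ?I ?B (u, n))) ys"
    by (simp only: implied_prefix_def join_full_def u merge_assoc un(3) case_prod_unfold fst_conv snd_conv)
  finally show ?thesis
    by (simp add: implied_prefix_def join_star_def u un(1))
qed

text \<open>The last density of the extension sequence implies all the earlier ones, by downward induction.
  The relation between \<open>G k\<close> and \<open>seq k\<close> then gives the encoding property, and \<open>G 0\<close> gives saturation.\<close>
lemma ex_encoding_density:
  "\<exists>h. is_density (full_space \<mu> {1..p}) h \<and> encodes \<mu> p t R K A D f h \<and>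
     (AE xs in mat_space \<mu> {1..p}. implied \<mu> {1..p} h xs = f xs)"
proof -
  let ?V = "\<lambda>k. mixed_space \<mu> p (t k) {1..t k} (t k)"
  obtain G where G: "\<And>k. k \<le> K \<Longrightarrow> G k \<in> borel_measurable (?V k)"
    and keep: "\<And>k. k \<le> K \<Longrightarrow> AE s in mixed_space \<mu> p (t k) (step_inds t R k) (t k).
        keep_indicators {1..t k} (step_inds t R k) (G k) s = seq k s"
    and G_step: "\<And>k. k < K \<Longrightarrow> AE (u, ys) in mixed_space \<mu> p (t k) {1..t k} (t (Suc k)) \<Otimes>\<^sub>M mat_space \<mu> {t k<..t (Suc k)}.
      implied \<mu> {t k<..t (Suc k)} (\<lambda>n. G (Suc k) (join_full {1..t k} {1..t k} {t k<..t (Suc k)} (u, n))) ys =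
      G k (join_star {t k<..t (Suc k)} {t (Suc k)<..p} (u, ys))"
    and G0: "G 0 = seq 0"
    using ex_extension_sequence by auto
  \<comment> \<open>The starred component of \<open>G K\<close> is indexed by the empty set, so it has one value only.\<close>
  define h where "h = (\<lambda>(x, m). G K (x, m, \<lambda>_. undefined))"
  have mat_none: "space (mat_space \<mu> {}) = {\<lambda>_. undefined}"
    by (auto simp: mat_space_def space_PiM)
  have h: "h \<in> borel_measurable (full_space \<mu> {1..p})"
  proof -
    have "(\<lambda>(x, m). (x, m, \<lambda>_. undefined)) \<in> full_space \<mu> {1..p} \<rightarrow>\<^sub>M ?V K"
      unfolding full_space_def mixed_space_def tK case_prod_unfold by (simp add: mat_none)
    from measurable_compose[OF this G[OF order_refl]] show ?thesis
      by (simp add: h_def split_beta')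
  qed

  have down: "AE s in ?V k. implied_prefix h (t k) s = G k s" if "k \<le> K" for k
    using that
  proof (induction k rule: inc_induct)
    case base
    have "implied_prefix h p s = G K s" if "s \<in> space (?V K)" for s
    proof -
      obtain x m xs where s: "s = (x, m, xs)"
        by (metis prod.exhaust)
      have sp: "x \<in> extensional {1..p}" "m \<in> extensional {1..p}" "xs = (\<lambda>_. undefined)"
        using that mat_none by (auto simp: s space_mixed_space tK space_PiM PiE_def)
      have "merge {1..p} {} (x, y) = x" "merge {1..p} {} (m, n) = m" for y n
        using sp by (auto simp: merge_def fun_eq_iff extensional_def)
      then show ?thesis
        by (simp add: s implied_prefix_def implied_def h_def sp(3) PiM_empty nn_integral_count_space_finite)
    qed
    then show ?case
      by (auto simp: tK)
  next
    case (step k)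
    then have k: "k < K"
      by simp
    let ?I = "{1..t k}" and ?B = "{t k<..t (Suc k)}" and ?Z = "{t (Suc k)<..p}"
    let ?C = "mixed_space \<mu> p (t k) ?I (t (Suc k))"
    have le: "t k \<le> t (Suc k)" "t (Suc k) \<le> p"
      using k t_less[of k] t_le_p[of "Suc k"] by auto
    have un: "{1..t (Suc k)} = ?I \<union> ?B"
      using le by auto
    have disj: "?I \<inter> ?B = {}"
      by auto
    have sfB: "\<And>j. j \<in> ?B \<Longrightarrow> sigma_finite_measure (\<mu> j)"
      using sf le by auto
    have "AE v in ?C \<Otimes>\<^sub>M full_space \<mu> ?B.
        implied_prefix h (t (Suc k)) (join_full ?I ?I ?B v) = G (Suc k) (join_full ?I ?I ?B v)"
      using step.IH unfolding un by (subst (asm) AE_join_full_iff[OF _ le disj sf]) auto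
    then have "AE (u, n) in ?C \<Otimes>\<^sub>M full_space \<mu> ?B.
        implied_prefix h (t (Suc k)) (join_full ?I ?I ?B (u, n)) = G (Suc k) (join_full ?I ?I ?B (u, n))"
      by (simp add: split_beta')
    \<comment> \<open>The left side is \<open>implied_prefix h (t k)\<close> by \<open>implied_prefix_join_star\<close>, the right side is \<open>G k\<close> by \<open>G_step\<close>.\<close>
    from implied_cong_AE[OF _ sfB this]
    have "AE (u, ys) in ?C \<Otimes>\<^sub>M mat_space \<mu> ?B.
        implied \<mu> ?B (\<lambda>n. implied_prefix h (t (Suc k)) (join_full ?I ?I ?B (u, n))) ys =
        implied \<mu> ?B (\<lambda>n. G (Suc k) (join_full ?I ?I ?B (u, n))) ys"
      by simp
    then have "AE v in ?C \<Otimes>\<^sub>M mat_space \<mu> ?B. implied_prefix h (t k) (join_star ?B ?Z v) = G k (join_star ?B ?Z v)"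
      using G_step[OF k] AE_space
    proof eventually_elim
      case (elim v)
      then show ?case
        using implied_prefix_join_star[OF le h, of "fst v" "snd v"] by (simp add: split_beta')
    qed
    then show ?case
      by (subst AE_join_star_iff[OF _ le sf]) auto
  qed

  have "encodes \<mu> p t R K A D f h"
    unfolding encodes_def
  proof
    fix k assume "k \<in> {1..K}"
    then have k: "k \<le> K"
      by simp
    have "AE s in mixed_space \<mu> p (t k) (step_inds t R k) (t k).
        keep_indicators {1..t k} (step_inds t R k) (implied_prefix h (t k)) s =
        keep_indicators {1..t k} (step_inds t R k) (G k) s"
      by (rule keep_indicators_cong_AE[OF _ step_inds_subset[OF k] t_le_p[OF k] sf down[OF k]]) simp_all
    then show "AE s in mixed_space \<mu> p (t k) (step_inds t R k) (t k).
        implied_mixed \<mu> p (t k) (step_inds t R k) h s = seq k s"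
      using keep[OF k] by eventually_elim (simp add: implied_mixed_eq)
  qed
  moreover have sat: "AE xs in mat_space \<mu> {1..p}. implied \<mu> {1..p} h xs = f xs"
  proof -
    have iv: "{0<..p} = {1..p}"
      by auto
    have iv0: "{1..0::nat} = {}"
      by simp
    have "nonsingular_map (mat_space \<mu> {1..p}) (mixed_space \<mu> p 0 {} 0) (\<lambda>xs. (\<lambda>_. undefined, \<lambda>_. undefined, xs))"
    proof (rule nonsingular_mapI)
      show "(\<lambda>xs. (\<lambda>_. undefined, \<lambda>_. undefined, xs)) \<in> mat_space \<mu> {1..p} \<rightarrow>\<^sub>M mixed_space \<mu> p 0 {} 0"
        by (simp add: mixed_space_def iv space_ind_space)
    qed (simp add: nn_integral_no_block)
    moreover have "AE s in mixed_space \<mu> p 0 {} 0. implied_prefix h 0 s = seq 0 s"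
      using down[OF le0, unfolded t0 G0] by (subst (asm) iv0)
    ultimately have "AE xs in mat_space \<mu> {1..p}.
        implied_prefix h 0 (\<lambda>_. undefined, \<lambda>_. undefined, xs) = seq 0 (\<lambda>_. undefined, \<lambda>_. undefined, xs)"
      by (rule AE_nonsingular_map)
    then show ?thesis
      by (simp add: implied_prefix_def implied_def iv merge_empty_left)
  qed
  moreover have "(\<integral>\<^sup>+ n. h n \<partial>full_space \<mu> {1..p}) = 1"
  proof -
    have "(\<integral>\<^sup>+ n. h n \<partial>full_space \<mu> {1..p}) = (\<integral>\<^sup>+ xs. implied \<mu> {1..p} h xs \<partial>mat_space \<mu> {1..p})"
      by (rule nn_integral_implied[OF _ sf h, symmetric]) simp_all
    also have "\<dots> = (\<integral>\<^sup>+ xs. f xs \<partial>mat_space \<mu> {1..p})"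
      by (rule nn_integral_cong_AE[OF sat])
    finally show ?thesis
      using f by (simp add: is_density_def)
  qed
  ultimately show ?thesis
    using h by (auto simp: is_density_def)
qed

end

theorem theorem1:
  fixes \<mu> :: "nat \<Rightarrow> 'a measure"
    and p K :: nat
    and t :: "nat \<Rightarrow> nat"
    and R :: "nat \<Rightarrow> nat set"
    and A :: "nat \<Rightarrow> ('a mixed \<Rightarrow> (nat \<Rightarrow> 'a option) \<Rightarrow> ennreal) \<Rightarrow>
                'a mixed \<Rightarrow> (nat \<Rightarrow> 'a) \<times> (nat \<Rightarrow> bool) \<Rightarrow> ennreal"
    and D :: "nat \<Rightarrow> ('a mixed \<times> (nat \<Rightarrow> 'a option) \<Rightarrow> ennreal) \<Rightarrow>
                'a mixed \<Rightarrow> (nat \<Rightarrow> 'a option) \<Rightarrow> ennreal"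
    and f :: "(nat \<Rightarrow> 'a option) \<Rightarrow> ennreal"
  assumes "\<And>j. j \<in> {1..p} \<Longrightarrow> sigma_finite_measure (\<mu> j)"
    and "t 0 = 0" and "t K = p" and "\<And>k. k < K \<Longrightarrow> t k < t (Suc k)"
    and "R 0 = {}" and "\<And>k. k \<in> {1..<K} \<Longrightarrow> R k \<subseteq> block t k \<union> R (k - 1)"
    and "\<And>k. k \<in> {1..K} \<Longrightarrow> identifying_assumption \<mu> p t R k (A k)"
    and "version_choice \<mu> p t R K D"
    and "is_density (mat_space \<mu> {1..p}) f"
  shows "\<exists>h. is_density (full_space \<mu> {1..p}) h \<and>
             encodes \<mu> p t R K A D f h \<and>
             (AE xs in mat_space \<mu> {1..p}. implied \<mu> {1..p} h xs = f xs)"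
proof -
  interpret sequential_identification \<mu> p K t R A D f
    by (rule sequential_identification.intro[OF assms])
  show ?thesis
    by (rule ex_encoding_density)
qed

end
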